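(* Let $m,p\ge 1$ be integers, and let $(a_n)_{n\in\mathbb{Z}}$ and $(b_n)_{n\in\mathbb{Z}}$ be $p$-periodic sequences of complex $m\times m$ matrices (that is, $a_{n+p}=a_n$ and $b_{n+p}=b_n$ for all $n\in\mathbb{Z}$) with $b_n=b_n^*$ for all $n$. Let $J:\ell^2(\mathbb{Z})^m\to\ell^2(\mathbb{Z})^m$ be the self-adjoint matrix-valued Jacobi operator $$(Jy)_n=a_n y_{n+1}+b_n y_n+a_{n-1}^*y_{n-1},\qquad n\in\mathbb{Z},\quad y=(y_n)_{n\in\mathbb{Z}}\in\ell^2(\mathbb{Z})^m,\ y_n\in\mathbb{C}^m.$$ Then the Lebesgue measure of the spectrum $\sigma(J)\subset\mathbb{R}$ satisfies $$\mathrm{mes}(\sigma(J))\le 4\min_{n}\mathrm{Tr}\big((a_na_n^* )^{1/2}\big).$$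
   Context: Here $\ell^2(\mathbb{Z})^m$ is the Hilbert space of square-summable sequences $(y_n)_{n\in\mathbb{Z}}$ with $y_n\in\mathbb{C}^m$, $\mathrm{mes}$ denotes Lebesgue measure on $\mathbb{R}$, $^*$ denotes the conjugate transpose, and $(a_na_n^* )^{1/2}$ is the positive semidefinite square root of the matrix $a_na_n^*$, so that $\mathrm{Tr}\big((a_na_n^* )^{1/2}\big)$ is the trace of this square root. The matrices $a_n$ are not assumed to be invertible. The minimum is over all $n\in\mathbb{Z}$ (equivalently, over one period). *)

theory Defs
  imports "HOL-Analysis.Analysis"
begin

definition conj_transpose :: "complex^'n^'m \<Rightarrow> complex^'m^'n" where
  "conj_transpose A = (\<chi> i j. cnj (A $ j $ i))"

definition hermitian :: "complex^'n^'n \<Rightarrow> bool" where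
  "hermitian A \<longleftrightarrow> conj_transpose A = A"

definition pos_semidef :: "complex^'n^'n \<Rightarrow> bool" where
  "pos_semidef A \<longleftrightarrow>
     hermitian A \<and> (\<forall>v. 0 \<le> Re (\<Sum>i\<in>UNIV. cnj (v $ i) * (A *v v) $ i))"

(* Only meaningful for positive semidefinite A, where the root exists and is unique. *)
definition psd_sqrt :: "complex^'n^'n \<Rightarrow> complex^'n^'n" where
  "psd_sqrt A = (THE S. pos_semidef S \<and> S ** S = A)"

definition ell2 :: "(int \<Rightarrow> complex^'m) set" where
  "ell2 = {y. (\<lambda>n. (norm (y n))\<^sup>2) summable_on UNIV}"

definition ell2_norm :: "(int \<Rightarrow> complex^'m) \<Rightarrow> real" where
  "ell2_norm y = sqrt (\<Sum>\<^sub>\<infinity>n. (norm (y n))\<^sup>2)"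

(* Operators on ell2 are represented by maps on all sequences; their values outside ell2
   are irrelevant. *)
definition bounded_op :: "((int \<Rightarrow> complex^'m) \<Rightarrow> (int \<Rightarrow> complex^'m)) \<Rightarrow> bool" where
  "bounded_op T \<longleftrightarrow>
     (\<forall>y\<in>ell2. T y \<in> ell2) \<and>
     (\<forall>x\<in>ell2. \<forall>y\<in>ell2. T (\<lambda>n. x n + y n) = (\<lambda>n. T x n + T y n)) \<and>
     (\<forall>c. \<forall>y\<in>ell2. T (\<lambda>n. c *s y n) = (\<lambda>n. c *s T y n)) \<and>
     (\<exists>C. \<forall>y\<in>ell2. ell2_norm (T y) \<le> C * ell2_norm y)"

(* T is meant to be an everywhere defined bounded operator on ell2; z is in the resolvent
   set if T - z has a bounded two-sided inverse R on ell2. *)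
definition resolvent_set :: "((int \<Rightarrow> complex^'m) \<Rightarrow> (int \<Rightarrow> complex^'m)) \<Rightarrow> complex set" where
  "resolvent_set T = {z. \<exists>R. bounded_op R \<and>
     (\<forall>y\<in>ell2. R (\<lambda>n. T y n - z *s y n) = y) \<and>
     (\<forall>y\<in>ell2. (\<lambda>n. T (R y) n - z *s R y n) = y)}"

definition spectrum :: "((int \<Rightarrow> complex^'m) \<Rightarrow> (int \<Rightarrow> complex^'m)) \<Rightarrow> complex set" where
  "spectrum T = - resolvent_set T"

definition jacobi ::
  "(int \<Rightarrow> complex^'m^'m) \<Rightarrow> (int \<Rightarrow> complex^'m^'m) \<Rightarrow> (int \<Rightarrow> complex^'m) \<Rightarrow> (int \<Rightarrow> complex^'m)" where
  "jacobi a b y =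
     (\<lambda>n. a n *v y (n + 1) + b n *v y n + conj_transpose (a (n - 1)) *v y (n - 1))"

end

theory Submission
  imports Defs "HOL-Computational_Algebra.Fundamental_Theorem_Algebra"
begin

text \<open>
  Choose a bond \<open>n0\<close> at which the minimum is attained; by periodicity its coefficient \<open>a n0\<close> recurs
  at every bond \<open>n0 + k * p\<close>. Cutting all these bonds splits the lattice into cells of \<open>p\<close>
  sites. With \<open>P = (a n0 a n0\<^sup>*)\<^sup>1\<^sup>/\<^sup>2\<close> there is a Hermitian \<open>Q\<close> of the same trace such that
  \<open>\<bar>2 Re \<langle>x, a n0 y\<rangle>\<bar> \<le> \<langle>x, P x\<rangle> + \<langle>y, Q y\<rangle>\<close> (lemma \<open>psd_sqrt_gram_dominates\<close>). So
  a bond may be replaced by \<open>\<plusminus> P\<close> at its left end and \<open>\<plusminus> Q\<close> at its right end: the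
  quadratic form of \<open>J\<close> lies between the forms of two operators that act cell by cell through
  finite Hermitian matrices \<open>A \<le> B\<close>, the same in every cell, with
  \<open>Tr (B - A) = 2 (Tr P + Tr Q) = 4 Tr P\<close>.

  Let \<open>\<nu>\<close> and \<open>\<mu>\<close> denote the eigenvalues of \<open>A\<close> and \<open>B\<close>. The number of \<open>\<nu>\<close> below \<open>x\<close> minus the number
  of \<open>\<mu>\<close> below \<open>x\<close> is a nonnegative integer whose integral over \<open>x\<close> is \<open>Tr (B - A)\<close>. Hence the two counts
  differ only on a set of measure at most \<open>4 Tr P\<close> (lemma
  \<open>splits_at_outside_small_set\<close>).

  Where the counts agree and \<open>x\<close> is not one of the \<open>\<nu>\<close>, the space of a cell is the direct sum
  of a subspace on which \<open>B < x\<close> and a subspace on which \<open>A > x\<close>: the two meet only in \<open>0\<close>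
  since \<open>A \<le> B\<close>, and their dimensions add up. Decomposing \<open>u = v + w\<close> in this way in each cell gives
  \<open>\<langle>(J - x) v, v\<rangle> \<le> - \<delta> |v|\<^sup>2\<close> and \<open>\<langle>(J - x) w, w\<rangle> \<ge> \<delta> |w|\<^sup>2\<close>. The cross terms of
  \<open>\<langle>(J - x) (v + w), w - v\<rangle>\<close> cancel because \<open>J - x\<close> is symmetric, so this number is at least
  \<open>\<delta> (|v|\<^sup>2 + |w|\<^sup>2)\<close> and \<open>J - x\<close> is bounded below (lemma \<open>J_bounded_below\<close>). A bounded
  symmetric operator on a Hilbert space that is bounded below is invertible, so \<open>x\<close> is in the
  resolvent set.
\<close>

section \<open>The spectral theorem for Hermitian matrices on a finite index set\<close>

text \<open>
  Elimination of one unknown with the help of one equation. This is the only fact about dimension that the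
  proof uses; independence and spanning of finite families are both read off from it, so
  that vectors can stay plain functions on a finite index set whose size depends on \<open>p\<close>.
\<close>
lemma homogeneous_system_nontrivial:
  fixes M :: "'e \<Rightarrow> 'k \<Rightarrow> 'f::field"
  assumes "finite E" "finite K" "card E < card K"
  shows "\<exists>c. (\<exists>k\<in>K. c k \<noteq> 0) \<and> (\<forall>e\<in>E. (\<Sum>k\<in>K. M e k * c k) = 0)"
  using assms
proof (induction E arbitrary: K M rule: finite_induct)
  case empty
  then have "K \<noteq> {}" by auto
  then show ?case by (intro exI[of _ "\<lambda>_. 1"]) auto
next
  case (insert e E)
  show ?case
  proof (cases "\<forall>k\<in>K. M e k = 0")
    case True
    obtain c where "\<exists>k\<in>K. c k \<noteq> 0" "\<forall>e\<in>E. (\<Sum>k\<in>K. M e k * c k) = 0"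
      using insert.IH[of K M] insert.prems insert.hyps by auto
    then show ?thesis using True by (intro exI[of _ c]) auto
  next
    case False
    then obtain k0 where k0: "k0 \<in> K" "M e k0 \<noteq> 0" by auto
    define K' where "K' = K - {k0}"
    have K': "finite K'" "K = insert k0 K'" "k0 \<notin> K'" "card E < card K'"
      using insert k0 by (auto simp: K'_def)
    define M' where "M' e' k = M e' k - M e' k0 * M e k / M e k0" for e' k
    obtain c where c: "\<exists>k\<in>K'. c k \<noteq> 0" "\<forall>e'\<in>E. (\<Sum>k\<in>K'. M' e' k * c k) = 0"
      using insert.IH[of K' M'] K' by auto
    define s where "s = (\<Sum>k\<in>K'. M e k * c k)"
    define c' where "c' = c(k0 := - s / M e k0)"
    have sum': "(\<Sum>k\<in>K. M e' k * c' k) = M e' k0 * (- s / M e k0) + (\<Sum>k\<in>K'. M e' k * c k)" for e'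
    proof -
      have "(\<Sum>k\<in>K'. M e' k * c' k) = (\<Sum>k\<in>K'. M e' k * c k)"
        using K'(3) by (intro sum.cong) (auto simp: c'_def)
      then show ?thesis using K' by (simp add: c'_def)
    qed
    have "(\<Sum>k\<in>K. M e k * c' k) = 0" using k0 by (simp add: sum' s_def)
    moreover have "(\<Sum>k\<in>K. M e' k * c' k) = 0" if "e' \<in> E" for e'
    proof -
      have "0 = (\<Sum>k\<in>K'. M' e' k * c k)" using c that by simp
      also have "\<dots> = (\<Sum>k\<in>K'. M e' k * c k - M e' k0 / M e k0 * (M e k * c k))"
        by (intro sum.cong) (auto simp: M'_def algebra_simps)
      also have "\<dots> = (\<Sum>k\<in>K'. M e' k * c k) - M e' k0 / M e k0 * s"
        by (simp add: sum_subtractf sum_distrib_left s_def)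
      finally show ?thesis by (simp add: sum')
    qed
    moreover have "\<exists>k\<in>K. c' k \<noteq> 0" using c(1) K' by (auto simp: c'_def)
    ultimately show ?thesis by (intro exI[of _ c']) auto
  qed
qed

definition cinner_on :: "'i set \<Rightarrow> ('i \<Rightarrow> complex) \<Rightarrow> ('i \<Rightarrow> complex) \<Rightarrow> complex" where
  "cinner_on I f g = (\<Sum>i\<in>I. cnj (f i) * g i)"

definition apply_on :: "'i set \<Rightarrow> ('i \<Rightarrow> 'i \<Rightarrow> complex) \<Rightarrow> ('i \<Rightarrow> complex) \<Rightarrow> 'i \<Rightarrow> complex" where
  "apply_on I A f = (\<lambda>i. \<Sum>j\<in>I. A i j * f j)"

definition hermitian_on :: "'i set \<Rightarrow> ('i \<Rightarrow> 'i \<Rightarrow> complex) \<Rightarrow> bool" where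
  "hermitian_on I A \<longleftrightarrow> (\<forall>i\<in>I. \<forall>j\<in>I. A j i = cnj (A i j))"

lemma cinner_on_cong: "(\<And>i. i \<in> I \<Longrightarrow> f i = f' i) \<Longrightarrow> (\<And>i. i \<in> I \<Longrightarrow> g i = g' i) \<Longrightarrow> cinner_on I f g = cinner_on I f' g'"
  unfolding cinner_on_def by (intro sum.cong) auto

lemma apply_on_cong: "(\<And>i. i \<in> I \<Longrightarrow> f i = g i) \<Longrightarrow> apply_on I A f = apply_on I A g"
  unfolding apply_on_def by (intro ext sum.cong) auto

lemma cinner_on_commute: "cinner_on I g f = cnj (cinner_on I f g)"
  unfolding cinner_on_def by (simp add: mult.commute)

lemma cinner_on_sum_right: "cinner_on I f (\<lambda>i. \<Sum>k\<in>K. c k * u k i) = (\<Sum>k\<in>K. c k * cinner_on I f (u k))"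
  unfolding cinner_on_def sum_distrib_left by (subst sum.swap) (simp add: mult_ac)

lemma cinner_on_sum_left: "cinner_on I (\<lambda>i. \<Sum>k\<in>K. c k * u k i) f = (\<Sum>k\<in>K. cnj (c k) * cinner_on I (u k) f)"
  by (subst cinner_on_commute, subst cinner_on_sum_right) (simp add: cinner_on_commute[of I f])

lemma apply_on_sum: "apply_on I A (\<lambda>i. \<Sum>k\<in>K. c k * u k i) = (\<lambda>i. \<Sum>k\<in>K. c k * apply_on I A (u k) i)"
  unfolding apply_on_def sum_distrib_left by (subst sum.swap) (simp add: mult_ac)

lemma apply_on_lin: "apply_on I A (\<lambda>i. c * f i + d * g i) = (\<lambda>i. c * apply_on I A f i + d * apply_on I A g i)"
  unfolding apply_on_def by (simp add: sum_distrib_left sum.distrib algebra_simps)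

lemma cinner_on_lin_right: "cinner_on I h (\<lambda>i. c * f i + d * g i) = c * cinner_on I h f + d * cinner_on I h g"
  unfolding cinner_on_def by (simp add: sum_distrib_left sum.distrib algebra_simps)

lemma cinner_on_self: "cinner_on I f f = complex_of_real (\<Sum>i\<in>I. (cmod (f i))\<^sup>2)"
  unfolding cinner_on_def of_real_sum by (intro sum.cong refl) (simp only: complex_norm_square mult.commute)

lemma cinner_on_self_pos: assumes "finite I" "i \<in> I" "f i \<noteq> 0" shows "0 < (\<Sum>i\<in>I. (cmod (f i))\<^sup>2)"
  using assms by (intro sum_pos2[of _ i]) auto

lemma hermitian_on_cinner_on:
  assumes "hermitian_on I A"
  shows "cinner_on I f (apply_on I A g) = cinner_on I (apply_on I A f) g"
proof -
  have "cinner_on I f (apply_on I A g) = (\<Sum>i\<in>I. \<Sum>j\<in>I. cnj (f i) * A i j * g j)"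
    unfolding cinner_on_def apply_on_def by (simp add: sum_distrib_left mult_ac)
  also have "\<dots> = (\<Sum>j\<in>I. \<Sum>i\<in>I. cnj (f i) * A i j * g j)" by (rule sum.swap)
  also have "\<dots> = cinner_on I (apply_on I A f) g"
    unfolding cinner_on_def apply_on_def cnj_sum sum_distrib_right
  proof (intro sum.cong refl)
    fix i j assume "i \<in> I" "j \<in> I"
    then have "A i j = cnj (A j i)" using assms unfolding hermitian_on_def by blast
    then show "cnj (f i) * A i j * g j = cnj (A j i * f i) * g j" by simp
  qed
  finally show ?thesis .
qed

text \<open>
  The vectors \<open>f, A f, A\<^sup>2 f, \<dots>\<close> are dependent, so some nonzero polynomial in \<open>A\<close> kills \<open>f\<close>. Splitting
  off linear factors one at a time, the last factor that is applied to a nonzero vector exhibits an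
  eigenvector. All vectors involved are polynomials in \<open>A\<close> applied to \<open>f\<close>, so they stay in the
  subspace \<open>S\<close>.
\<close>
lemma invariant_subspace_eigenvector:
  fixes A :: "'i \<Rightarrow> 'i \<Rightarrow> complex"
  assumes S_lin: "\<And>c d f g. S f \<Longrightarrow> S g \<Longrightarrow> S (\<lambda>i. c * f i + d * g i)"
    and S_inv: "\<And>f. S f \<Longrightarrow> S (apply_on I A f)"
    and fin: "finite I" and f: "S f" "\<exists>i\<in>I. f i \<noteq> 0"
  obtains g r where "S g" "\<exists>i\<in>I. g i \<noteq> 0" "\<forall>i\<in>I. apply_on I A g i = r * g i"
proof -
  let ?F = "apply_on I A"
  define P where "P p f i = (\<Sum>k\<le>degree p. coeff p k * (?F ^^ k) f i)" for p f i
  have P_bound: "P p f i = (\<Sum>k\<le>n. coeff p k * (?F ^^ k) f i)" if "degree p \<le> n" for p f i n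
    unfolding P_def using that by (intro sum.mono_neutral_left) (auto simp: coeff_eq_0)
  have F_lin: "(?F ^^ k) (\<lambda>i. c * f i + d * g i) = (\<lambda>i. c * (?F ^^ k) f i + d * (?F ^^ k) g i)"
    for k c d f g
    by (induction k) (auto simp: apply_on_lin)
  have factor: "P ([:-r, 1:] * q) f i = P q (\<lambda>i. 1 * ?F f i + (-r) * f i) i" for r q f i
  proof -
    let ?n = "degree q"
    have co: "coeff ([:-r,1:] * q) k = - r * coeff q k + (case k of 0 \<Rightarrow> 0 | Suc j \<Rightarrow> coeff q j)" for k
      by (simp add: coeff_pCons split: nat.split)
    have "P ([:-r, 1:] * q) f i = (\<Sum>k\<le>Suc ?n. coeff ([:-r,1:] * q) k * (?F ^^ k) f i)"
      by (rule P_bound) (use degree_mult_le[of "[:-r,1:]" q] in auto)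
    also have "\<dots> = (\<Sum>k\<le>Suc ?n. (-r) * (coeff q k * (?F ^^ k) f i)) +
        (\<Sum>k\<le>Suc ?n. (case k of 0 \<Rightarrow> 0 | Suc j \<Rightarrow> coeff q j) * (?F ^^ k) f i)"
      unfolding co sum.distrib[symmetric] by (simp add: algebra_simps)
    also have "(\<Sum>k\<le>Suc ?n. (-r) * (coeff q k * (?F ^^ k) f i)) =
        (\<Sum>k\<le>?n. (-r) * (coeff q k * (?F ^^ k) f i))"
      by (simp add: coeff_eq_0)
    also have "(\<Sum>k\<le>Suc ?n. (case k of 0 \<Rightarrow> 0 | Suc j \<Rightarrow> coeff q j) * (?F ^^ k) f i) =
        (\<Sum>k\<le>?n. coeff q k * (?F ^^ k) (?F f) i)"
      by (subst sum.atMost_Suc_shift) (simp add: funpow_swap1)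
    also have "(\<Sum>k\<le>?n. (-r) * (coeff q k * (?F ^^ k) f i)) + (\<Sum>k\<le>?n. coeff q k * (?F ^^ k) (?F f) i)
        = P q (\<lambda>i. 1 * ?F f i + (-r) * f i) i"
      unfolding F_lin P_def sum.distrib[symmetric] by (simp add: algebra_simps)
    finally show ?thesis .
  qed
  have main: "\<exists>g r. S g \<and> (\<exists>i\<in>I. g i \<noteq> 0) \<and> (\<forall>i\<in>I. ?F g i = r * g i)"
    if "p \<noteq> 0" "S f" "\<exists>i\<in>I. f i \<noteq> 0" "\<forall>i\<in>I. P p f i = 0" for p f
    using that
  proof (induction "degree p" arbitrary: p f rule: less_induct)
    case less
    have "degree p \<noteq> 0"
    proof
      assume d: "degree p = 0"
      then have "coeff p 0 \<noteq> 0" using less.prems(1) leading_coeff_0_iff[of p] by simp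
      then show False using less.prems(3,4) d by (auto simp: P_def)
    qed
    then obtain r where "poly p r = 0"
      using fundamental_theorem_of_algebra[of p] by (auto simp: constant_degree)
    then have "[:-r, 1:] dvd p" by (simp add: poly_eq_0_iff_dvd)
    then obtain q where q: "p = [:-r, 1:] * q" ..
    have q0: "q \<noteq> 0" using q less.prems(1) by auto
    have dq: "degree q < degree p"
      unfolding q using q0 by (subst degree_mult_eq) auto
    define h where "h = (\<lambda>i. 1 * ?F f i + (-r) * f i)"
    have h: "S h" unfolding h_def by (intro S_lin S_inv less.prems)
    show ?case
    proof (cases "\<exists>i\<in>I. h i \<noteq> 0")
      case True
      show ?thesis
      proof (rule less.hyps[OF dq q0 h True])
        show "\<forall>i\<in>I. P q h i = 0" using less.prems(4) unfolding q factor h_def by blast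
      qed
    next
      case False
      then show ?thesis using less.prems by (intro exI[of _ f] exI[of _ r]) (auto simp: h_def)
    qed
  qed
  obtain c where c: "\<exists>k\<in>{..card I}. c k \<noteq> 0" "\<forall>i\<in>I. (\<Sum>k\<in>{..card I}. (?F ^^ k) f i * c k) = 0"
    using homogeneous_system_nontrivial[of I "{..card I}" "\<lambda>i k. (?F ^^ k) f i"] fin by auto
  define p where "p = (\<Sum>k\<le>card I. monom (c k) k)"
  have cp: "coeff p k = (if k \<le> card I then c k else 0)" for k
    unfolding p_def by (auto simp: coeff_sum)
  have "p \<noteq> 0"
  proof
    assume "p = 0"
    then have "c k = 0" if "k \<le> card I" for k using cp[of k] that by simp
    then show False using c(1) by auto
  qed
  moreover have "P p f i = 0" if "i \<in> I" for i
  proof -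
    have "degree p \<le> card I" by (rule degree_le) (auto simp: cp)
    then have "P p f i = (\<Sum>k\<le>card I. coeff p k * (?F ^^ k) f i)" by (rule P_bound)
    also have "\<dots> = (\<Sum>k\<le>card I. (?F ^^ k) f i * c k)" by (intro sum.cong) (auto simp: cp)
    finally show ?thesis using c(2) that by simp
  qed
  ultimately show ?thesis using main[of p f] f that by blast
qed

text \<open>
  An orthonormal family of fewer than \<open>card I\<close> eigenvectors has a nontrivial orthogonal complement,
  invariant because \<open>A\<close> is Hermitian; an eigenvector found there extends the family.
\<close>
lemma hermitian_on_spectral:
  fixes A :: "'i \<Rightarrow> 'i \<Rightarrow> complex"
  assumes fin: "finite I" and her: "hermitian_on I A"
  obtains U :: "'i \<Rightarrow> 'i \<Rightarrow> complex" and \<mu> :: "'i \<Rightarrow> real"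
  where "\<And>k l. k \<in> I \<Longrightarrow> l \<in> I \<Longrightarrow> cinner_on I (U k) (U l) = (if k = l then 1 else 0)"
    and "\<And>k i. k \<in> I \<Longrightarrow> i \<in> I \<Longrightarrow> apply_on I A (U k) i = complex_of_real (\<mu> k) * U k i"
proof -
  let ?F = "apply_on I A"
  have "\<exists>u (m :: nat \<Rightarrow> real). (\<forall>k<n. \<forall>l<n. cinner_on I (u k) (u l) = (if k = l then 1 else 0)) \<and>
          (\<forall>k<n. \<forall>i\<in>I. ?F (u k) i = complex_of_real (m k) * u k i)" if "n \<le> card I" for n
    using that
  proof (induction n)
    case 0
    then show ?case by auto
  next
    case (Suc n)
    have "n \<le> card I" using Suc.prems by simp
    from Suc.IH[OF this] obtain u and m :: "nat \<Rightarrow> real"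
      where on: "\<And>k l. k < n \<Longrightarrow> l < n \<Longrightarrow> cinner_on I (u k) (u l) = (if k = l then 1 else 0)"
        and ev: "\<And>k i. k < n \<Longrightarrow> i \<in> I \<Longrightarrow> ?F (u k) i = complex_of_real (m k) * u k i"
      by blast
    define S where "S f \<longleftrightarrow> (\<forall>k<n. cinner_on I (u k) f = 0)" for f
    obtain f where f: "\<exists>i\<in>I. f i \<noteq> 0" "\<forall>k\<in>{..<n}. (\<Sum>i\<in>I. cnj (u k i) * f i) = 0"
      using homogeneous_system_nontrivial[of "{..<n}" I "\<lambda>k i. cnj (u k i)"] fin Suc.prems by auto
    have Sf: "S f" using f(2) by (auto simp: S_def cinner_on_def)
    have S_inv: "S (?F g)" if "S g" for g
      unfolding S_def
    proof (intro allI impI)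
      fix k assume k: "k < n"
      have "cinner_on I (u k) (?F g) = cinner_on I (?F (u k)) g" by (rule hermitian_on_cinner_on[OF her])
      also have "\<dots> = cinner_on I (\<lambda>i. complex_of_real (m k) * u k i) g"
        using ev[OF k] by (intro cinner_on_cong) auto
      also have "\<dots> = complex_of_real (m k) * cinner_on I (u k) g"
        by (simp add: cinner_on_def sum_distrib_left mult_ac)
      finally show "cinner_on I (u k) (?F g) = 0" using that k by (simp add: S_def)
    qed
    have S_lin: "S (\<lambda>i. c * f i + d * g i)" if "S f" "S g" for c d f g
      using that by (simp add: S_def cinner_on_lin_right)
    obtain g r where g: "S g" "\<exists>i\<in>I. g i \<noteq> 0" "\<forall>i\<in>I. ?F g i = r * g i"
      using invariant_subspace_eigenvector[of S I A f, OF S_lin S_inv fin Sf f(1)] by blast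
    define N where "N = (\<Sum>i\<in>I. (cmod (g i))\<^sup>2)"
    have N: "N > 0" "cinner_on I g g = complex_of_real N"
      using g(2) cinner_on_self_pos fin by (auto simp: N_def cinner_on_self)
    have "r * cinner_on I g g = cinner_on I g (?F g)"
      using g(3) by (simp add: cinner_on_def sum_distrib_left mult_ac)
    also have "\<dots> = cinner_on I (?F g) g" by (rule hermitian_on_cinner_on[OF her])
    also have "\<dots> = cnj r * cinner_on I g g"
      using g(3) by (simp add: cinner_on_def sum_distrib_left mult_ac)
    finally have "r = cnj r" using N by simp
    then have r: "r = complex_of_real (Re r)" by (simp add: complex_eq_iff)
    define h where "h i = g i / complex_of_real (sqrt N)" for i
    have hh: "cinner_on I h h = 1"
    proof -
      have "cinner_on I h h = cinner_on I g g / complex_of_real (sqrt N * sqrt N)"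
        unfolding cinner_on_def h_def sum_divide_distrib by (intro sum.cong refl) (simp del: real_sqrt_mult_self)
      then show ?thesis using N by simp
    qed
    have uh: "cinner_on I (u k) h = 0" if "k < n" for k
    proof -
      have "cinner_on I (u k) h = cinner_on I (u k) g / complex_of_real (sqrt N)"
        by (simp add: cinner_on_def h_def sum_divide_distrib)
      then show ?thesis using g(1) that by (simp add: S_def)
    qed
    have hu: "cinner_on I h (u k) = 0" if "k < n" for k
      using uh[OF that] cinner_on_commute[of I h "u k"] by simp
    have Fh: "?F h i = complex_of_real (Re r) * h i" if "i \<in> I" for i
    proof -
      have "?F h i = ?F g i / complex_of_real (sqrt N)"
        by (simp add: apply_on_def h_def sum_divide_distrib)
      then show ?thesis using g(3) r that by (simp add: h_def)
    qed
    show ?case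
    proof (intro exI[of _ "u(n := h)"] exI[of _ "m(n := Re r)"] conjI allI impI ballI)
      fix k l assume "k < Suc n" "l < Suc n"
      then show "cinner_on I ((u(n := h)) k) ((u(n := h)) l) = (if k = l then 1 else 0)"
        using on[of k l] hh uh[of k] hu[of l] by (auto simp: less_Suc_eq)
    next
      fix k i assume "k < Suc n" "i \<in> I"
      then show "?F ((u(n := h)) k) i = complex_of_real ((m(n := Re r)) k) * (u(n := h)) k i"
        using ev[of k i] Fh[of i] by (auto simp: less_Suc_eq)
    qed
  qed
  from this[OF order_refl] obtain u and m :: "nat \<Rightarrow> real"
    where on: "\<And>k l. k < card I \<Longrightarrow> l < card I \<Longrightarrow> cinner_on I (u k) (u l) = (if k = l then 1 else 0)"
      and ev: "\<And>k i. k < card I \<Longrightarrow> i \<in> I \<Longrightarrow> ?F (u k) i = complex_of_real (m k) * u k i"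
    by blast
  obtain e where e: "bij_betw e I {0..<card I}" using ex_bij_betw_finite_nat[OF fin] by blast
  show ?thesis
  proof (rule that[of "u \<circ> e" "m \<circ> e"])
    fix k l assume "k \<in> I" "l \<in> I"
    then have "e k < card I" "e l < card I" "e k = e l \<longleftrightarrow> k = l"
      using e by (auto simp: bij_betw_def inj_on_def)
    then show "cinner_on I ((u \<circ> e) k) ((u \<circ> e) l) = (if k = l then 1 else 0)"
      by (simp add: on)
  next
    fix k i assume "k \<in> I" "i \<in> I"
    moreover from this have "e k < card I" using e by (auto simp: bij_betw_def)
    ultimately show "apply_on I A ((u \<circ> e) k) i = complex_of_real ((m \<circ> e) k) * (u \<circ> e) k i"
      by (simp add: ev)
  qed
qed

definition quad_form_on :: "'i set \<Rightarrow> ('i \<Rightarrow> 'i \<Rightarrow> complex) \<Rightarrow> ('i \<Rightarrow> complex) \<Rightarrow> real" where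
  "quad_form_on I A f = Re (cinner_on I f (apply_on I A f))"

definition norm_sq_on :: "'i set \<Rightarrow> ('i \<Rightarrow> complex) \<Rightarrow> real" where
  "norm_sq_on I f = (\<Sum>i\<in>I. (cmod (f i))\<^sup>2)"

text \<open>
  The rows \<open>U k\<close> form an orthonormal basis of eigenvectors. They are numbered by \<open>I\<close> itself, which makes
  the number of eigenvectors equal to the dimension by construction.
\<close>
definition eigenbasis ::
  "'i set \<Rightarrow> ('i \<Rightarrow> 'i \<Rightarrow> complex) \<Rightarrow> ('i \<Rightarrow> 'i \<Rightarrow> complex) \<Rightarrow> ('i \<Rightarrow> real) \<Rightarrow> bool" where
  "eigenbasis I A U \<mu> \<longleftrightarrow>
     (\<forall>k\<in>I. \<forall>l\<in>I. cinner_on I (U k) (U l) = (if k = l then 1 else 0)) \<and>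
     (\<forall>k\<in>I. \<forall>i\<in>I. apply_on I A (U k) i = complex_of_real (\<mu> k) * U k i)"

lemma hermitian_on_eigenbasis:
  assumes "finite I" "hermitian_on I A"
  obtains U \<mu> where "eigenbasis I A U \<mu>"
  using hermitian_on_spectral[OF assms] unfolding eigenbasis_def by metis

lemma norm_sq_on_cinner_on: "complex_of_real (norm_sq_on I f) = cinner_on I f f"
  by (simp add: norm_sq_on_def cinner_on_self)

lemma norm_sq_on_cong: "(\<And>i. i \<in> I \<Longrightarrow> f i = g i) \<Longrightarrow> norm_sq_on I f = norm_sq_on I g"
  unfolding norm_sq_on_def by (intro sum.cong) auto

lemma quad_form_on_cong: "(\<And>i. i \<in> I \<Longrightarrow> f i = g i) \<Longrightarrow> quad_form_on I A f = quad_form_on I A g"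
  unfolding quad_form_on_def using apply_on_cong[of I f g A] by (simp cong: cinner_on_cong)

lemma norm_sq_on_nonneg: "norm_sq_on I f \<ge> 0"
  by (simp add: norm_sq_on_def sum_nonneg)

lemma norm_sq_on_uminus: "norm_sq_on I (\<lambda>i. - f i) = norm_sq_on I f"
  by (simp add: norm_sq_on_def)

lemma quad_form_on_uminus: "quad_form_on I A (\<lambda>i. - f i) = quad_form_on I A f"
  by (simp add: quad_form_on_def cinner_on_def apply_on_def sum_negf)

lemma eigenbasis_cinner_on_comb:
  assumes "eigenbasis I A U \<mu>" "finite I" "K \<subseteq> I"
  shows "cinner_on I (\<lambda>i. \<Sum>k\<in>K. c k * U k i) (\<lambda>i. \<Sum>k\<in>K. d k * U k i) = (\<Sum>k\<in>K. cnj (c k) * d k)"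
proof -
  have fK: "finite K" using assms finite_subset by blast
  have "cinner_on I (U k) (\<lambda>i. \<Sum>k\<in>K. d k * U k i) = d k" if "k \<in> K" for k
  proof -
    have "cinner_on I (U k) (\<lambda>i. \<Sum>k\<in>K. d k * U k i) = (\<Sum>l\<in>K. d l * (if k = l then 1 else 0))"
      unfolding cinner_on_sum_right
    proof (intro sum.cong refl)
      fix l assume "l \<in> K"
      then have "k \<in> I" "l \<in> I" using that assms(3) by auto
      then show "d l * cinner_on I (U k) (U l) = d l * (if k = l then 1 else 0)"
        using assms(1) by (simp add: eigenbasis_def)
    qed
    also have "\<dots> = (\<Sum>l\<in>K. if k = l then d l else 0)" by (intro sum.cong) auto
    finally show ?thesis using that fK by simp
  qed
  then show ?thesis unfolding cinner_on_sum_left by simp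
qed

lemma eigenbasis_norm_sq_on:
  assumes "eigenbasis I A U \<mu>" "finite I" "K \<subseteq> I"
  shows "norm_sq_on I (\<lambda>i. \<Sum>k\<in>K. c k * U k i) = (\<Sum>k\<in>K. (cmod (c k))\<^sup>2)"
proof -
  have "complex_of_real (norm_sq_on I (\<lambda>i. \<Sum>k\<in>K. c k * U k i)) = cinner_on K c c"
    using eigenbasis_cinner_on_comb[OF assms] by (simp add: norm_sq_on_cinner_on cinner_on_def)
  then show ?thesis unfolding cinner_on_self of_real_eq_iff .
qed

lemma eigenbasis_quad_form_on:
  assumes "eigenbasis I A U \<mu>" "finite I" "K \<subseteq> I"
  shows "quad_form_on I A (\<lambda>i. \<Sum>k\<in>K. c k * U k i) = (\<Sum>k\<in>K. \<mu> k * (cmod (c k))\<^sup>2)"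
proof -
  have "cinner_on I (\<lambda>i. \<Sum>k\<in>K. c k * U k i) (apply_on I A (\<lambda>i. \<Sum>k\<in>K. c k * U k i)) =
      cinner_on I (\<lambda>i. \<Sum>k\<in>K. c k * U k i) (\<lambda>i. \<Sum>k\<in>K. (c k * complex_of_real (\<mu> k)) * U k i)"
  proof (rule cinner_on_cong)
    fix i assume "i \<in> I"
    then show "apply_on I A (\<lambda>i. \<Sum>k\<in>K. c k * U k i) i = (\<Sum>k\<in>K. (c k * complex_of_real (\<mu> k)) * U k i)"
      unfolding apply_on_sum using assms by (intro sum.cong) (auto simp: eigenbasis_def)
  qed simp
  also have "\<dots> = (\<Sum>k\<in>K. cnj (c k) * (c k * complex_of_real (\<mu> k)))"
    by (rule eigenbasis_cinner_on_comb[OF assms])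
  also have "\<dots> = complex_of_real (\<Sum>k\<in>K. \<mu> k * (cmod (c k))\<^sup>2)"
    unfolding of_real_sum of_real_mult complex_norm_square by (simp add: mult_ac)
  finally show ?thesis by (simp add: quad_form_on_def)
qed

text \<open>
  Adding \<open>f\<close> to the basis gives more vectors than coordinates, hence a dependence, in which the
  coefficient of \<open>f\<close> cannot vanish.
\<close>
lemma eigenbasis_expansion:
  assumes eb: "eigenbasis I A U \<mu>" and fin: "finite I" and i: "i \<in> I"
  shows "f i = (\<Sum>k\<in>I. cinner_on I (U k) f * U k i)"
proof -
  \<comment> \<open>\<open>None\<close> stands for the additional vector \<open>f\<close>.\<close>
  define M where "M i = case_option (f i) (\<lambda>k. U k i)" for i
  have "card (insert None (Some ` I)) = Suc (card I)"
    using fin by (simp add: card_image image_iff)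
  then obtain c where c: "\<exists>k\<in>insert None (Some ` I). c k \<noteq> 0"
      "\<forall>i\<in>I. (\<Sum>k\<in>insert None (Some ` I). M i k * c k) = 0"
    using homogeneous_system_nontrivial[of I "insert None (Some ` I)" M] fin by auto
  have c2: "f i * c None + (\<Sum>k\<in>I. c (Some k) * U k i) = 0" if "i \<in> I" for i
    using c(2) that fin by (simp add: image_iff M_def sum.reindex mult.commute)
  have cN: "c None \<noteq> 0"
  proof
    assume *: "c None = 0"
    have "(\<Sum>k\<in>I. (cmod (c (Some k)))\<^sup>2) = norm_sq_on I (\<lambda>i. \<Sum>k\<in>I. c (Some k) * U k i)"
      by (rule eigenbasis_norm_sq_on[OF eb fin order_refl, symmetric])
    also have "\<dots> = norm_sq_on I (\<lambda>i. 0)" by (intro norm_sq_on_cong) (use c2 * in auto)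
    finally have "\<forall>k\<in>I. c (Some k) = 0" using fin by (simp add: norm_sq_on_def sum_nonneg_eq_0_iff)
    then show False using c(1) * by auto
  qed
  define d where "d k = - c (Some k) / c None" for k
  have f: "f i = (\<Sum>k\<in>I. d k * U k i)" if "i \<in> I" for i
  proof -
    have "f i = - (\<Sum>k\<in>I. c (Some k) * U k i) / c None"
      using c2[OF that] cN by (simp add: field_simps eq_neg_iff_add_eq_0)
    then show ?thesis by (simp add: d_def sum_divide_distrib sum_negf)
  qed
  have "cinner_on I (U k) f = d k" if "k \<in> I" for k
  proof -
    have "cinner_on I (U k) f = (\<Sum>l\<in>I. d l * cinner_on I (U k) (U l))"
      unfolding cinner_on_sum_right[symmetric] using f by (intro cinner_on_cong) auto
    also have "\<dots> = (\<Sum>l\<in>I. if k = l then d l else 0)"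
      using eb that by (intro sum.cong) (auto simp: eigenbasis_def)
    finally show ?thesis using that fin by simp
  qed
  then show ?thesis using f[OF i] by simp
qed

lemma eigenbasis_complete:
  assumes eb: "eigenbasis I A U \<mu>" and fin: "finite I" and "i \<in> I" "j \<in> I"
  shows "(\<Sum>k\<in>I. cnj (U k j) * U k i) = (if i = j then 1 else 0)"
proof -
  have "cinner_on I (U k) (\<lambda>i. if i = j then 1 else 0) = cnj (U k j)" for k
    using assms by (simp add: cinner_on_def if_distrib[where f="\<lambda>x. _ * x"] cong: if_cong)
  then show ?thesis
    using eigenbasis_expansion[OF eb fin \<open>i \<in> I\<close>, of "\<lambda>i. if i = j then 1 else 0"] by simp
qed

lemma eigenbasis_entry:
  assumes eb: "eigenbasis I A U \<mu>" and fin: "finite I" and "i \<in> I" "j \<in> I"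
  shows "A i j = (\<Sum>k\<in>I. complex_of_real (\<mu> k) * U k i * cnj (U k j))"
proof -
  have "(\<Sum>k\<in>I. complex_of_real (\<mu> k) * U k i * cnj (U k j)) =
      (\<Sum>k\<in>I. (\<Sum>l\<in>I. A i l * U k l) * cnj (U k j))"
    using eb assms by (intro sum.cong) (auto simp: eigenbasis_def apply_on_def)
  also have "\<dots> = (\<Sum>l\<in>I. A i l * (\<Sum>k\<in>I. cnj (U k j) * U k l))"
    unfolding sum_distrib_left sum_distrib_right by (subst sum.swap) (simp add: mult_ac)
  also have "\<dots> = (\<Sum>l\<in>I. if l = j then A i l else 0)"
    using assms by (intro sum.cong) (auto simp: eigenbasis_complete[OF eb fin])
  finally show ?thesis using assms by simp
qed

lemma eigenbasis_trace:
  assumes eb: "eigenbasis I A U \<mu>" and fin: "finite I"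
  shows "(\<Sum>i\<in>I. A i i) = complex_of_real (\<Sum>k\<in>I. \<mu> k)"
proof -
  have "(\<Sum>i\<in>I. A i i) = (\<Sum>i\<in>I. \<Sum>k\<in>I. complex_of_real (\<mu> k) * U k i * cnj (U k i))"
    using eigenbasis_entry[OF eb fin] by (intro sum.cong) auto
  also have "\<dots> = (\<Sum>k\<in>I. complex_of_real (\<mu> k) * cinner_on I (U k) (U k))"
    unfolding cinner_on_def sum_distrib_left by (subst sum.swap) (simp add: mult_ac)
  also have "\<dots> = complex_of_real (\<Sum>k\<in>I. \<mu> k)"
    using eb by (simp add: eigenbasis_def)
  finally show ?thesis .
qed

section \<open>Eigenvalue counts of two ordered Hermitian matrices\<close>

text \<open>
  From here on \<open>A \<le> B\<close> as quadratic forms, \<open>\<nu>\<close> are the eigenvalues of \<open>A\<close> and \<open>\<mu>\<close> those of \<open>B\<close>.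
\<close>
context
  fixes I :: "'i set" and A B U W \<mu> \<nu>
  assumes fin: "finite I" and ebB: "eigenbasis I B U \<mu>" and ebA: "eigenbasis I A W \<nu>"
    and le: "\<And>f. quad_form_on I A f \<le> quad_form_on I B f"
begin

text \<open>
  A common vector \<open>v = - w\<close> of the two spectral subspaces would satisfy
  \<open>x |w|\<^sup>2 \<le> \<langle>w, A w\<rangle> = \<langle>v, A v\<rangle> \<le> \<langle>v, B v\<rangle> < x |v|\<^sup>2\<close> unless it is zero.
\<close>
lemma spectral_subspaces_independent:
  assumes K: "K \<subseteq> I" "\<And>k. k \<in> K \<Longrightarrow> \<mu> k < x" and L: "L \<subseteq> I" "\<And>k. k \<in> L \<Longrightarrow> x \<le> \<nu> k"
    and 0: "\<And>i. i \<in> I \<Longrightarrow> (\<Sum>k\<in>K. c k * U k i) + (\<Sum>k\<in>L. d k * W k i) = 0"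
  shows "(\<forall>k\<in>K. c k = 0) \<and> (\<forall>k\<in>L. d k = 0)"
proof -
  have fK: "finite K" "finite L" using fin K(1) L(1) finite_subset by blast+
  let ?v = "\<lambda>i. \<Sum>k\<in>K. c k * U k i" and ?w = "\<lambda>i. \<Sum>k\<in>L. d k * W k i"
  have vw: "?v i = - ?w i" if "i \<in> I" for i using 0[OF that] by (simp add: eq_neg_iff_add_eq_0)
  have n: "norm_sq_on I ?v = norm_sq_on I ?w"
    using norm_sq_on_cong[of I ?v "\<lambda>i. - ?w i", OF vw] by (simp add: norm_sq_on_uminus)
  have q: "quad_form_on I A ?v = quad_form_on I A ?w"
    using quad_form_on_cong[of I ?v "\<lambda>i. - ?w i" A, OF vw] by (simp add: quad_form_on_uminus)
  have "x * norm_sq_on I ?w = (\<Sum>k\<in>L. x * (cmod (d k))\<^sup>2)"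
    by (simp add: eigenbasis_norm_sq_on[OF ebA fin L(1)] sum_distrib_left)
  also have "\<dots> \<le> (\<Sum>k\<in>L. \<nu> k * (cmod (d k))\<^sup>2)"
    by (intro sum_mono mult_right_mono) (use L in auto)
  also have "\<dots> = quad_form_on I A ?v" by (simp add: eigenbasis_quad_form_on[OF ebA fin L(1)] q)
  also have "\<dots> \<le> quad_form_on I B ?v" by (rule le)
  finally have "x * (\<Sum>k\<in>K. (cmod (c k))\<^sup>2) \<le> (\<Sum>k\<in>K. \<mu> k * (cmod (c k))\<^sup>2)"
    using eigenbasis_quad_form_on[OF ebB fin K(1), of c] eigenbasis_norm_sq_on[OF ebB fin K(1), of c] n by simp
  then have "(\<Sum>k\<in>K. (x - \<mu> k) * (cmod (c k))\<^sup>2) \<le> 0"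
    by (simp add: sum_distrib_left sum_subtractf algebra_simps)
  moreover have nn: "(x - \<mu> k) * (cmod (c k))\<^sup>2 \<ge> 0" if "k \<in> K" for k
    using K(2)[OF that] by simp
  ultimately have "(\<Sum>k\<in>K. (x - \<mu> k) * (cmod (c k))\<^sup>2) = 0"
    by (intro antisym sum_nonneg) auto
  then have "\<forall>k\<in>K. (x - \<mu> k) * (cmod (c k))\<^sup>2 = 0"
    using sum_nonneg_eq_0_iff[OF fK(1) nn] by simp
  then have c: "\<forall>k\<in>K. c k = 0" using K(2) by fastforce
  then have "norm_sq_on I ?w = 0" using n by (simp add: norm_sq_on_def)
  then have "\<forall>k\<in>L. d k = 0"
    unfolding eigenbasis_norm_sq_on[OF ebA fin L(1)] using fK by (simp add: sum_nonneg_eq_0_iff)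
  with c show ?thesis by blast
qed

text \<open>
  Otherwise the independent subspaces of the previous lemma would have dimensions of sum larger than
  the whole space.
\<close>
lemma eigenvalue_count_mono:
  "card {k\<in>I. \<mu> k < x} \<le> card {k\<in>I. \<nu> k < x}"
proof (rule ccontr)
  let ?K = "{k\<in>I. \<mu> k < x}" and ?L = "{k\<in>I. x \<le> \<nu> k}"
  assume "\<not> ?thesis"
  moreover have "card {k\<in>I. \<nu> k < x} + card ?L = card I"
    using fin by (subst card_Un_disjoint[symmetric]) (auto intro!: arg_cong[of _ _ card])
  ultimately have "card I < card (?K <+> ?L)" using fin by (simp add: card_Plus)
  moreover have "finite (?K <+> ?L)" using fin by simp
  ultimately obtain c where c: "\<exists>k\<in>?K <+> ?L. c k \<noteq> 0"
      "\<forall>i\<in>I. (\<Sum>k\<in>?K <+> ?L. case_sum (\<lambda>k. U k i) (\<lambda>k. W k i) k * c k) = 0"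
    using homogeneous_system_nontrivial[of I "?K <+> ?L" "\<lambda>i. case_sum (\<lambda>k. U k i) (\<lambda>k. W k i)"] fin
    by auto
  have 0: "(\<Sum>k\<in>?K. c (Inl k) * U k i) + (\<Sum>k\<in>?L. c (Inr k) * W k i) = 0" if "i \<in> I" for i
    using c(2) that fin by (simp add: sum.Plus mult.commute)
  have "(\<forall>k\<in>?K. c (Inl k) = 0) \<and> (\<forall>k\<in>?L. c (Inr k) = 0)"
    by (rule spectral_subspaces_independent[OF _ _ _ _ 0]) auto
  then show False using c(1) by auto
qed

text \<open>
  The two families of eigenvectors are independent and have \<open>card I\<close> members together, so \<open>f\<close> is a
  combination of them for the same reason as in \<open>eigenbasis_expansion\<close>.
\<close>
lemma spectral_subspaces_span:
  assumes count: "card {k\<in>I. \<mu> k < x} = card {k\<in>I. \<nu> k < x}"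
  shows "\<exists>c d. \<forall>i\<in>I. f i = (\<Sum>k\<in>{k\<in>I. \<mu> k < x}. c k * U k i) + (\<Sum>k\<in>{k\<in>I. x \<le> \<nu> k}. d k * W k i)"
proof -
  let ?K = "{k\<in>I. \<mu> k < x}" and ?L = "{k\<in>I. x \<le> \<nu> k}"
  let ?X = "insert None (Some ` (?K <+> ?L))"
  have "card {k\<in>I. \<nu> k < x} + card ?L = card I"
    using fin by (subst card_Un_disjoint[symmetric]) (auto intro!: arg_cong[of _ _ card])
  then have "card (?K <+> ?L) = card I" using fin count by (simp add: card_Plus)
  moreover have fKL: "finite (?K <+> ?L)" using fin by simp
  ultimately have "card ?X = Suc (card I)" by (simp add: card_image image_iff)
  define M where "M i = case_option (f i) (case_sum (\<lambda>k. U k i) (\<lambda>k. W k i))" for i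
  obtain c where c: "\<exists>k\<in>?X. c k \<noteq> 0" "\<forall>i\<in>I. (\<Sum>k\<in>?X. M i k * c k) = 0"
    using homogeneous_system_nontrivial[of I ?X M] fin fKL \<open>card ?X = _\<close> by auto
  have eq: "f i * c None + ((\<Sum>k\<in>?K. c (Some (Inl k)) * U k i) + (\<Sum>k\<in>?L. c (Some (Inr k)) * W k i)) = 0"
    if "i \<in> I" for i
  proof -
    have "(\<Sum>k\<in>?X. M i k * c k) = M i None * c None + (\<Sum>k\<in>?K <+> ?L. M i (Some k) * c (Some k))"
      using fKL by (subst sum.insert) (auto simp: sum.reindex)
    also have "(\<Sum>k\<in>?K <+> ?L. M i (Some k) * c (Some k)) =
        (\<Sum>k\<in>?K. c (Some (Inl k)) * U k i) + (\<Sum>k\<in>?L. c (Some (Inr k)) * W k i)"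
      using fin by (subst sum.Plus) (auto simp: M_def mult.commute)
    finally show ?thesis using c(2) that by (simp add: M_def)
  qed
  have cN: "c None \<noteq> 0"
  proof
    assume *: "c None = 0"
    have 0: "(\<Sum>k\<in>?K. c (Some (Inl k)) * U k i) + (\<Sum>k\<in>?L. c (Some (Inr k)) * W k i) = 0"
      if "i \<in> I" for i using eq[OF that] * by simp
    have "(\<forall>k\<in>?K. c (Some (Inl k)) = 0) \<and> (\<forall>k\<in>?L. c (Some (Inr k)) = 0)"
      by (rule spectral_subspaces_independent[OF _ _ _ _ 0]) auto
    then show False using c(1) * by auto
  qed
  show ?thesis
  proof (intro exI ballI)
    fix i assume "i \<in> I"
    have "f i = - ((\<Sum>k\<in>?K. c (Some (Inl k)) * U k i) + (\<Sum>k\<in>?L. c (Some (Inr k)) * W k i)) / c None"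
      using eq[OF \<open>i \<in> I\<close>] cN by (simp add: field_simps eq_neg_iff_add_eq_0)
    then show "f i = (\<Sum>k\<in>?K. (- c (Some (Inl k)) / c None) * U k i) +
        (\<Sum>k\<in>?L. (- c (Some (Inr k)) / c None) * W k i)"
      by (simp add: sum_divide_distrib sum_negf add_divide_distrib diff_divide_distrib)
  qed
qed

end

lemma cmod_sum_mult_sq_le:
  fixes a b :: "'i \<Rightarrow> complex"
  shows "(cmod (\<Sum>i\<in>I. a i * b i))\<^sup>2 \<le> norm_sq_on I b * norm_sq_on I a"
proof -
  have "cmod (\<Sum>i\<in>I. a i * b i) \<le> (\<Sum>i\<in>I. cmod (a i) * cmod (b i))"
    by (rule order_trans[OF norm_sum]) (simp add: norm_mult)
  then have "(cmod (\<Sum>i\<in>I. a i * b i))\<^sup>2 \<le> (\<Sum>i\<in>I. cmod (a i) * cmod (b i))\<^sup>2"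
    by (intro power_mono) auto
  also have "\<dots> \<le> norm_sq_on I a * norm_sq_on I b"
    unfolding norm_sq_on_def by (rule Cauchy_Schwarz_ineq_sum)
  finally show ?thesis by (simp add: mult.commute)
qed

text \<open>
  For Hermitian \<open>A \<le> B\<close> this means that \<open>x\<close> lies in a spectral gap of both matrices with equally many
  eigenvalues below it. It is phrased through quadratic forms because these can be summed over
  infinitely many cells, and the bound \<open>C\<close> keeps the parts of a square summable sequence
  square summable.
\<close>
definition splits_at ::
  "'i set \<Rightarrow> ('i \<Rightarrow> 'i \<Rightarrow> complex) \<Rightarrow> ('i \<Rightarrow> 'i \<Rightarrow> complex) \<Rightarrow> real \<Rightarrow> bool" where
  "splits_at I A B x \<longleftrightarrow> (\<exists>\<delta>>0. \<exists>C. \<forall>f. \<exists>v w.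
      (\<forall>i\<in>I. f i = v i + w i) \<and> norm_sq_on I v \<le> C * norm_sq_on I f \<and> norm_sq_on I w \<le> C * norm_sq_on I f \<and>
      quad_form_on I B v \<le> (x - \<delta>) * norm_sq_on I v \<and> (x + \<delta>) * norm_sq_on I w \<le> quad_form_on I A w)"

text \<open>
  The unit vectors are decomposed first; by linearity this decomposes every \<open>f\<close> with a
  uniform bound \<open>C\<close>. The gap \<open>\<delta>\<close> exists since there are finitely many eigenvalues and none of the
  relevant ones equals \<open>x\<close>.
\<close>
lemma eigenvalue_counts_agree_imp_splits_at:
  fixes I :: "'i set" and \<mu> \<nu> :: "'i \<Rightarrow> real"
  assumes fin: "finite I" and ebB: "eigenbasis I B U \<mu>" and ebA: "eigenbasis I A W \<nu>"
    and le: "\<And>f. quad_form_on I A f \<le> quad_form_on I B f"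
    and count: "card {k\<in>I. \<mu> k < x} = card {k\<in>I. \<nu> k < x}" and x: "x \<notin> \<nu> ` I"
  shows "splits_at I A B x"
proof -
  define K where "K = {k\<in>I. \<mu> k < x}"
  define L where "L = {k\<in>I. x \<le> \<nu> k}"
  have KL: "K \<subseteq> I" "L \<subseteq> I" "finite K" "finite L" using fin by (auto simp: K_def L_def)
  define D where "D = insert 1 ((\<lambda>k. x - \<mu> k) ` K \<union> (\<lambda>k. \<nu> k - x) ` L)"
  define \<delta> where "\<delta> = Min D"
  have D: "finite D" "D \<noteq> {}" using KL by (auto simp: D_def)
  have pos: "0 < d" if "d \<in> D" for d
    using that x by (auto simp: D_def K_def L_def less_le)
  have \<delta>: "\<delta> > 0" using D pos by (simp add: \<delta>_def)
  have \<delta>_le: "\<delta> \<le> d" if "d \<in> D" for d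
    unfolding \<delta>_def using D(1) that by (rule Min_le)
  have \<delta>K: "\<mu> k \<le> x - \<delta>" if "k \<in> K" for k
    using \<delta>_le[of "x - \<mu> k"] that by (simp add: D_def)
  have \<delta>L: "x + \<delta> \<le> \<nu> k" if "k \<in> L" for k
    using \<delta>_le[of "\<nu> k - x"] that by (simp add: D_def)
  have "\<forall>i0. \<exists>c d. \<forall>i\<in>I. (if i = i0 then 1 else 0) = (\<Sum>k\<in>K. c k * U k i) + (\<Sum>k\<in>L. d k * W k i)"
  proof
    fix i0
    show "\<exists>c d. \<forall>i\<in>I. (if i = i0 then 1 else 0) = (\<Sum>k\<in>K. c k * U k i) + (\<Sum>k\<in>L. d k * W k i)"
      using spectral_subspaces_span[OF fin ebB ebA le count, of "\<lambda>i. if i = i0 then 1 else 0"]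
      unfolding K_def L_def .
  qed
  then obtain c where "\<forall>i0. \<exists>d. \<forall>i\<in>I.
      (if i = i0 then 1 else 0) = (\<Sum>k\<in>K. c i0 k * U k i) + (\<Sum>k\<in>L. d k * W k i)"
    by (rule exE[OF choice])
  then obtain d where cd: "\<forall>i0. \<forall>i\<in>I.
      (if i = i0 then 1 else 0) = (\<Sum>k\<in>K. c i0 k * U k i) + (\<Sum>k\<in>L. d i0 k * W k i)"
    by (rule exE[OF choice])
  define C where "C = max (\<Sum>k\<in>K. norm_sq_on I (\<lambda>j. c j k)) (\<Sum>k\<in>L. norm_sq_on I (\<lambda>j. d j k))"
  show ?thesis
    unfolding splits_at_def
  proof (rule exI[of _ \<delta>], rule conjI[OF \<delta>], rule exI[of _ C], rule allI)
    fix f :: "'i \<Rightarrow> complex"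
    define cf where "cf k = (\<Sum>j\<in>I. f j * c j k)" for k
    define df where "df k = (\<Sum>j\<in>I. f j * d j k)" for k
    define v where "v i = (\<Sum>k\<in>K. cf k * U k i)" for i
    define w where "w i = (\<Sum>k\<in>L. df k * W k i)" for i
    have "f i = v i + w i" if "i \<in> I" for i
    proof -
      have "f i = (\<Sum>j\<in>I. f j * (if i = j then 1 else 0))"
        using that fin by (simp add: if_distrib[where f="\<lambda>x. _ * x"] cong: if_cong)
      also have "\<dots> = (\<Sum>j\<in>I. f j * (\<Sum>k\<in>K. c j k * U k i)) + (\<Sum>j\<in>I. f j * (\<Sum>k\<in>L. d j k * W k i))"
        unfolding cd[rule_format, OF that] by (simp add: distrib_left sum.distrib)
      also have "(\<Sum>j\<in>I. f j * (\<Sum>k\<in>K. c j k * U k i)) = v i"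
        unfolding v_def cf_def sum_distrib_left sum_distrib_right
        by (subst sum.swap) (simp add: mult_ac)
      also have "(\<Sum>j\<in>I. f j * (\<Sum>k\<in>L. d j k * W k i)) = w i"
        unfolding w_def df_def sum_distrib_left sum_distrib_right
        by (subst sum.swap) (simp add: mult_ac)
      finally show ?thesis .
    qed
    moreover have nv: "norm_sq_on I v = (\<Sum>k\<in>K. (cmod (cf k))\<^sup>2)"
      unfolding v_def by (rule eigenbasis_norm_sq_on[OF ebB fin KL(1)])
    moreover have nw: "norm_sq_on I w = (\<Sum>k\<in>L. (cmod (df k))\<^sup>2)"
      unfolding w_def by (rule eigenbasis_norm_sq_on[OF ebA fin KL(2)])
    moreover have "norm_sq_on I v \<le> C * norm_sq_on I f"
    proof -
      have "norm_sq_on I v \<le> (\<Sum>k\<in>K. norm_sq_on I (\<lambda>j. c j k)) * norm_sq_on I f"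
        unfolding nv cf_def sum_distrib_right by (intro sum_mono cmod_sum_mult_sq_le)
      also have "\<dots> \<le> C * norm_sq_on I f" by (intro mult_right_mono norm_sq_on_nonneg) (simp add: C_def)
      finally show ?thesis .
    qed
    moreover have "norm_sq_on I w \<le> C * norm_sq_on I f"
    proof -
      have "norm_sq_on I w \<le> (\<Sum>k\<in>L. norm_sq_on I (\<lambda>j. d j k)) * norm_sq_on I f"
        unfolding nw df_def sum_distrib_right by (intro sum_mono cmod_sum_mult_sq_le)
      also have "\<dots> \<le> C * norm_sq_on I f" by (intro mult_right_mono norm_sq_on_nonneg) (simp add: C_def)
      finally show ?thesis .
    qed
    moreover have "quad_form_on I B v \<le> (x - \<delta>) * norm_sq_on I v"
      unfolding nv sum_distrib_left
      unfolding v_def eigenbasis_quad_form_on[OF ebB fin KL(1)]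
      by (intro sum_mono mult_right_mono \<delta>K) auto
    moreover have "(x + \<delta>) * norm_sq_on I w \<le> quad_form_on I A w"
      unfolding nw sum_distrib_left
      unfolding w_def eigenbasis_quad_form_on[OF ebA fin KL(2)]
      by (intro sum_mono mult_right_mono \<delta>L) auto
    ultimately show "\<exists>v w. (\<forall>i\<in>I. f i = v i + w i) \<and> norm_sq_on I v \<le> C * norm_sq_on I f \<and> norm_sq_on I w \<le> C * norm_sq_on I f \<and>
      quad_form_on I B v \<le> (x - \<delta>) * norm_sq_on I v \<and> (x + \<delta>) * norm_sq_on I w \<le> quad_form_on I A w"
      by blast
  qed
qed

lemma has_bochner_integral_step_difference:
  fixes a b :: real
  shows "has_bochner_integral lborel (\<lambda>x. indicator {a<..} x - indicator {b<..} x :: real) (b - a)"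
proof -
  have *: "has_bochner_integral lborel (\<lambda>x. indicator {a<..} x - indicator {b<..} x :: real) (b - a)"
    if "a \<le> b" for a b :: real
  proof -
    have "(\<lambda>x. indicator {a<..} x - indicator {b<..} x :: real) = indicator {a<..b}"
      using that by (auto simp: indicator_def fun_eq_iff)
    then show ?thesis
      using has_bochner_integral_real_indicator[of "{a<..b}" lborel] that by simp
  qed
  show ?thesis
  proof (cases "a \<le> b")
    case False
    then show ?thesis using has_bochner_integral_minus[OF *[of b a]] by simp
  qed (use * in auto)
qed

text \<open>
  A layer-cake argument: the difference of the counts is a nonnegative integer, so it dominates
  the indicator of the set where it is nonzero, and each pair \<open>\<nu> k, \<mu> k\<close> contributes \<open>\<mu> k - \<nu> k\<close> to
  its integral, in whatever order the eigenvalues are listed.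
\<close>
lemma eigenvalue_counts_differ_measure:
  fixes \<mu> \<nu> :: "'i \<Rightarrow> real"
  assumes fin: "finite I" and mono: "\<And>x. card {k\<in>I. \<mu> k < x} \<le> card {k\<in>I. \<nu> k < x}"
  defines "Z \<equiv> {x. card {k\<in>I. \<mu> k < x} \<noteq> card {k\<in>I. \<nu> k < x}}"
  shows "Z \<in> sets borel" "emeasure lborel Z \<le> ennreal ((\<Sum>k\<in>I. \<mu> k) - (\<Sum>k\<in>I. \<nu> k))"
proof -
  define F where "F x = (\<Sum>k\<in>I. indicator {\<nu> k<..} x - indicator {\<mu> k<..} x :: real)" for x
  have cnt: "(\<Sum>k\<in>I. indicator {m k<..} x :: real) = card {k\<in>I. m k < x}" for m :: "'i \<Rightarrow> real" and x
    using fin by (simp add: indicator_def sum.If_cases Collect_conj_eq)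
  have F: "F x = real (card {k\<in>I. \<nu> k < x}) - real (card {k\<in>I. \<mu> k < x})" for x
    unfolding F_def sum_subtractf cnt ..
  have int: "has_bochner_integral lborel F (\<Sum>k\<in>I. \<mu> k - \<nu> k)"
    unfolding F_def by (intro has_bochner_integral_sum has_bochner_integral_step_difference)
  have meas: "F \<in> borel_measurable borel" unfolding F_def by measurable
  have Z: "Z = {x. F x \<noteq> 0}" unfolding Z_def F by auto
  show "Z \<in> sets borel" unfolding Z using meas by measurable
  have F0: "F x \<ge> 0" for x using mono[of x] by (simp add: F)
  have F1: "indicator Z x \<le> ennreal (F x)" for x
  proof (cases "x \<in> Z")
    case True
    then have "card {k\<in>I. \<mu> k < x} < card {k\<in>I. \<nu> k < x}" using mono[of x] by (simp add: Z_def)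
    then have "1 \<le> F x" by (simp add: F)
    then have "ennreal 1 \<le> ennreal (F x)" by (rule ennreal_leI)
    then show ?thesis using True by simp
  qed simp
  have "emeasure lborel Z = (\<integral>\<^sup>+x. indicator Z x \<partial>lborel)"
    using \<open>Z \<in> sets borel\<close> by simp
  also have "\<dots> \<le> (\<integral>\<^sup>+x. ennreal (F x) \<partial>lborel)" by (intro nn_integral_mono F1)
  also have "\<dots> = ennreal (\<Sum>k\<in>I. \<mu> k - \<nu> k)"
    using int F0 by (simp add: nn_integral_eq_integral has_bochner_integral_iff)
  finally show "emeasure lborel Z \<le> ennreal ((\<Sum>k\<in>I. \<mu> k) - (\<Sum>k\<in>I. \<nu> k))"
    by (simp add: sum_subtractf)
qed

lemma splits_at_outside_small_set:
  fixes I :: "'i set"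
  assumes fin: "finite I" and her: "hermitian_on I A" "hermitian_on I B"
    and le: "\<And>f. quad_form_on I A f \<le> quad_form_on I B f"
  obtains Z :: "real set" where "Z \<in> sets lebesgue"
    "emeasure lebesgue Z \<le> ennreal (Re (\<Sum>i\<in>I. B i i - A i i))"
    "\<And>x. x \<notin> Z \<Longrightarrow> splits_at I A B x"
proof -
  obtain W \<nu> where A: "eigenbasis I A W \<nu>" using hermitian_on_eigenbasis[OF fin her(1)] by blast
  obtain U \<mu> where B: "eigenbasis I B U \<mu>" using hermitian_on_eigenbasis[OF fin her(2)] by blast
  define Z where "Z = {x. card {k\<in>I. \<mu> k < x} \<noteq> card {k\<in>I. \<nu> k < x}}"
  have Z: "Z \<in> sets borel" "emeasure lborel Z \<le> ennreal ((\<Sum>k\<in>I. \<mu> k) - (\<Sum>k\<in>I. \<nu> k))"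
    using eigenvalue_counts_differ_measure[OF fin eigenvalue_count_mono[OF fin B A le]]
    unfolding Z_def by blast+
  have E: "\<nu> ` I \<in> sets borel" using fin by (intro borel_closed finite_imp_closed) auto
  show ?thesis
  proof (rule that[of "Z \<union> \<nu> ` I"])
    show "Z \<union> \<nu> ` I \<in> sets lebesgue" using Z(1) E by auto
    have "emeasure lebesgue (Z \<union> \<nu> ` I) = emeasure lborel (Z \<union> \<nu> ` I)" using Z(1) E by simp
    also have "\<dots> \<le> emeasure lborel Z + emeasure lborel (\<nu> ` I)"
      using Z(1) E by (intro emeasure_subadditive) auto
    also have "\<dots> = emeasure lborel Z"
      using fin by (simp add: emeasure_lborel_countable countable_finite)
    also have "\<dots> \<le> ennreal (Re (\<Sum>i\<in>I. B i i - A i i))"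
      using Z(2) eigenbasis_trace[OF A fin] eigenbasis_trace[OF B fin] by (simp add: sum_subtractf)
    finally show "emeasure lebesgue (Z \<union> \<nu> ` I) \<le> ennreal (Re (\<Sum>i\<in>I. B i i - A i i))" .
    show "splits_at I A B x" if "x \<notin> Z \<union> \<nu> ` I" for x
      using eigenvalue_counts_agree_imp_splits_at[OF fin B A le, of x] that by (auto simp: Z_def)
  qed
qed

section \<open>The positive square root of a Gram matrix\<close>

abbreviation cvec_inner :: "complex^'n \<Rightarrow> complex^'n \<Rightarrow> complex" where
  "cvec_inner x y \<equiv> cinner_on UNIV (($) x) (($) y)"

abbreviation mat_fun :: "complex^'n^'m \<Rightarrow> 'm \<Rightarrow> 'n \<Rightarrow> complex" where
  "mat_fun M \<equiv> \<lambda>i j. M $ i $ j"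

lemma inner_complex_Re: "inner z w = Re (cnj z * w)" for z w :: complex
  by (simp add: inner_complex_def)

lemma scaleR_complex: "r *\<^sub>R z = complex_of_real r * z" for z :: complex
  by (simp add: scaleR_conv_of_real)

lemma matrix_vector_mult_scaleR_complex: "A *v (r *\<^sub>R x) = r *\<^sub>R (A *v x)" for A :: "complex^'n^'m"
  by (simp add: vec_eq_iff matrix_vector_mult_def scaleR_sum_right)

lemma inner_vec_cvec_inner: "inner x y = Re (cvec_inner x y)" for x y :: "complex^'n"
  by (simp add: inner_vec_def cinner_on_def inner_complex_Re)

lemma hermitian_iff: "hermitian M \<longleftrightarrow> hermitian_on UNIV (mat_fun M)"
proof -
  have "hermitian M \<longleftrightarrow> (\<forall>i j. cnj (M $ j $ i) = M $ i $ j)"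
    by (simp only: hermitian_def conj_transpose_def vec_eq_iff vec_lambda_beta)
  also have "\<dots> \<longleftrightarrow> (\<forall>i j. M $ j $ i = cnj (M $ i $ j))" by (blast intro: sym)
  finally show ?thesis by (simp only: hermitian_on_def ball_UNIV)
qed

lemma pos_semidef_iff: "pos_semidef M \<longleftrightarrow> hermitian M \<and> (\<forall>v. 0 \<le> inner v (M *v v))"
  by (simp add: pos_semidef_def inner_vec_cvec_inner cinner_on_def)

lemma cvec_inner_adjoint: "cvec_inner x (A *v y) = cvec_inner (conj_transpose A *v x) y"
proof -
  have "cvec_inner x (A *v y) = (\<Sum>i\<in>UNIV. \<Sum>j\<in>UNIV. cnj (x $ i) * A $ i $ j * y $ j)"
    by (simp add: cinner_on_def matrix_vector_mult_def sum_distrib_left mult_ac)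
  also have "\<dots> = (\<Sum>j\<in>UNIV. \<Sum>i\<in>UNIV. cnj (x $ i) * A $ i $ j * y $ j)" by (rule sum.swap)
  also have "\<dots> = cvec_inner (conj_transpose A *v x) y"
    by (simp add: cinner_on_def matrix_vector_mult_def conj_transpose_def sum_distrib_left sum_distrib_right mult_ac)
  finally show ?thesis .
qed

lemma inner_adjoint: "inner x (A *v y) = inner (conj_transpose A *v x) y" for x :: "complex^'m"
  by (simp add: inner_vec_cvec_inner cvec_inner_adjoint)

lemma conj_transpose_conj_transpose [simp]: "conj_transpose (conj_transpose A) = A"
  by (simp add: conj_transpose_def vec_eq_iff)

lemma norm_vec_norm_sq_on: "(norm x)\<^sup>2 = norm_sq_on UNIV (($) x)" for x :: "complex^'n"
  unfolding norm_sq_on_def norm_vec_def L2_set_def by (simp add: sum_nonneg)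

lemma pos_semidef_gram: "pos_semidef (a ** conj_transpose a)"
proof -
  have "hermitian (a ** conj_transpose a)"
    by (auto simp: hermitian_def conj_transpose_def matrix_matrix_mult_def vec_eq_iff mult.commute)
  moreover have "0 \<le> inner v ((a ** conj_transpose a) *v v)" for v
    by (simp add: matrix_vector_mul_assoc[symmetric] inner_adjoint[of v a])
  ultimately show ?thesis by (simp add: pos_semidef_iff)
qed

lemma hermitian_diff: "hermitian A \<Longrightarrow> hermitian B \<Longrightarrow> hermitian (A - B)"
  by (auto simp: hermitian_def conj_transpose_def vec_eq_iff)

text \<open>
  Let \<open>D = S - T\<close>. Then \<open>S D + D T = S\<^sup>2 - T\<^sup>2 = 0\<close>. For an eigenvector \<open>v\<close> of \<open>D\<close> with
  eigenvalue \<open>d \<noteq> 0\<close> this gives \<open>d (\<langle>v, S v\<rangle> + \<langle>v, T v\<rangle>) = 0\<close>, so both terms vanish, and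
  so does their difference \<open>d |v|\<^sup>2\<close>. Hence all eigenvalues of \<open>D\<close> are zero.
\<close>
lemma psd_square_root_unique:
  fixes S T :: "complex^'n^'n"
  assumes S: "pos_semidef S" and T: "pos_semidef T" and sq: "S ** S = T ** T"
  shows "S = T"
proof -
  define D where "D = S - T"
  have her: "hermitian D" using S T by (simp add: D_def hermitian_diff pos_semidef_def)
  obtain U d where eb: "eigenbasis UNIV (mat_fun D) U d"
    using hermitian_on_eigenbasis[of UNIV "mat_fun D"] her by (auto simp: hermitian_iff)
  have "d k = 0" for k
  proof (rule ccontr)
    assume d: "d k \<noteq> 0"
    define v where "v = (\<chi> i. U k i)"
    have "apply_on UNIV (mat_fun D) (U k) i = complex_of_real (d k) * U k i" for i
      using eb by (simp add: eigenbasis_def)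
    then have Dv: "D *v v = d k *\<^sub>R v"
      by (simp add: v_def vec_eq_iff matrix_vector_mult_def apply_on_def scaleR_complex)
    have "cvec_inner v v = cinner_on UNIV (U k) (U k)" by (simp add: v_def cinner_on_def)
    then have vv: "inner v v = 1" using eb by (simp add: inner_vec_cvec_inner eigenbasis_def)
    have "S *v (D *v v) + D *v (T *v v) = 0"
      unfolding D_def matrix_vector_mult_diff_distrib matrix_vector_mult_diff_rdistrib
      using sq by (simp add: matrix_vector_mul_assoc)
    then have "0 = inner v (S *v (D *v v)) + inner v (D *v (T *v v))"
      by (simp flip: inner_add_right)
    also have "inner v (S *v (D *v v)) = d k * inner v (S *v v)"
      unfolding Dv by (simp add: matrix_vector_mult_scaleR_complex)
    also have "inner v (D *v (T *v v)) = d k * inner v (T *v v)"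
      using her Dv by (simp add: inner_adjoint[of v D] hermitian_def)
    finally have "inner v (S *v v) + inner v (T *v v) = 0" using d by (simp add: distrib_left[symmetric])
    moreover have "inner v (S *v v) \<ge> 0" "inner v (T *v v) \<ge> 0"
      using S T by (auto simp: pos_semidef_iff)
    ultimately have "inner v (S *v v) = 0" "inner v (T *v v) = 0" by linarith+
    then have "inner v (D *v v) = 0"
      by (simp add: D_def matrix_vector_mult_diff_rdistrib inner_diff_right)
    then show False using Dv vv d by simp
  qed
  then have "D $ i $ j = 0" for i j
    using eigenbasis_entry[OF eb finite UNIV_I UNIV_I, of i j] by simp
  then show ?thesis by (simp add: D_def vec_eq_iff)
qed

text \<open>The matrix \<open>\<Sum>k. s k w k (w k)\<^sup>*\<close>.\<close>
definition rank_one_sum :: "('k \<Rightarrow> real) \<Rightarrow> ('k \<Rightarrow> complex^'n) \<Rightarrow> complex^'n^'n" where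
  "rank_one_sum s w = (\<chi> i j. \<Sum>k\<in>UNIV. complex_of_real (s k) * (w k $ i) * cnj (w k $ j))"

lemma hermitian_rank_one_sum: "hermitian (rank_one_sum s w)"
  by (simp add: hermitian_def conj_transpose_def rank_one_sum_def vec_eq_iff mult_ac)

lemma rank_one_sum_mult_vec:
  "(rank_one_sum s w *v y) $ i = (\<Sum>k\<in>UNIV. complex_of_real (s k) * cvec_inner (w k) y * w k $ i)"
proof -
  have "(rank_one_sum s w *v y) $ i =
      (\<Sum>j\<in>UNIV. \<Sum>k\<in>UNIV. complex_of_real (s k) * (w k $ i) * cnj (w k $ j) * y $ j)"
    by (simp add: rank_one_sum_def matrix_vector_mult_def sum_distrib_right)
  also have "\<dots> = (\<Sum>k\<in>UNIV. \<Sum>j\<in>UNIV. complex_of_real (s k) * (w k $ i) * cnj (w k $ j) * y $ j)"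
    by (rule sum.swap)
  also have "\<dots> = (\<Sum>k\<in>UNIV. complex_of_real (s k) * (w k $ i) * cvec_inner (w k) y)"
    by (simp add: cinner_on_def sum_distrib_left mult.assoc)
  finally show ?thesis by (simp add: mult.assoc mult.commute[of _ "w _ $ i"])
qed

lemma inner_rank_one_sum:
  fixes w :: "'k::finite \<Rightarrow> complex^'n"
  shows "inner y (rank_one_sum s w *v y) = (\<Sum>k\<in>UNIV. s k * (cmod (cvec_inner (w k) y))\<^sup>2)"
proof -
  have "cvec_inner y (rank_one_sum s w *v y) =
      cinner_on UNIV (($) y) (\<lambda>i. \<Sum>k\<in>UNIV. (complex_of_real (s k) * cvec_inner (w k) y) * w k $ i)"
    by (simp add: cinner_on_def[of _ "($) y"] rank_one_sum_mult_vec)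
  also have "\<dots> = (\<Sum>k\<in>UNIV. complex_of_real (s k) * cvec_inner (w k) y * cnj (cvec_inner (w k) y))"
    unfolding cinner_on_sum_right by (simp add: cinner_on_commute[of UNIV "($) y"])
  also have "\<dots> = complex_of_real (\<Sum>k\<in>UNIV. s k * (cmod (cvec_inner (w k) y))\<^sup>2)"
    unfolding of_real_sum of_real_mult complex_norm_square by (simp add: mult_ac)
  finally show ?thesis by (simp add: inner_vec_cvec_inner)
qed

lemma trace_rank_one_sum:
  fixes w :: "'k::finite \<Rightarrow> complex^'n"
  shows "trace (rank_one_sum s w) = (\<Sum>k\<in>UNIV. complex_of_real (s k) * cvec_inner (w k) (w k))"
proof -
  have "trace (rank_one_sum s w) =
      (\<Sum>i\<in>UNIV. \<Sum>k\<in>UNIV. complex_of_real (s k) * (w k $ i) * cnj (w k $ i))"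
    by (simp add: trace_def rank_one_sum_def)
  also have "\<dots> = (\<Sum>k\<in>UNIV. \<Sum>i\<in>UNIV. complex_of_real (s k) * (w k $ i) * cnj (w k $ i))"
    by (rule sum.swap)
  finally show ?thesis by (simp add: cinner_on_def sum_distrib_left mult_ac)
qed

lemma psd_sqrt_spectral:
  fixes M :: "complex^'n^'n"
  assumes psd: "pos_semidef M" and eb: "eigenbasis UNIV (mat_fun M) U \<mu>"
  shows "0 \<le> \<mu> k" "psd_sqrt M = rank_one_sum (\<lambda>k. sqrt (\<mu> k)) (\<lambda>k. \<chi> i. U k i)"
proof -
  let ?u = "\<lambda>k. \<chi> i. U k i"
  define S where "S = rank_one_sum (\<lambda>k. sqrt (\<mu> k)) ?u"
  have on: "cvec_inner (?u k) (?u l) = (if k = l then 1 else 0)" for k l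
    using eb by (simp add: eigenbasis_def cinner_on_def)
  have \<mu>: "0 \<le> \<mu> k" for k
  proof -
    have "apply_on UNIV (mat_fun M) (U k) i = complex_of_real (\<mu> k) * U k i" for i
      using eb by (simp add: eigenbasis_def)
    then have "M *v ?u k = \<mu> k *\<^sub>R ?u k"
      by (simp add: vec_eq_iff matrix_vector_mult_def apply_on_def scaleR_complex)
    then have "inner (?u k) (M *v ?u k) = \<mu> k" using on[of k k] by (simp add: inner_vec_cvec_inner[of "?u k" "?u k"])
    then show ?thesis using psd by (simp add: pos_semidef_iff flip: \<open>inner (?u k) (M *v ?u k) = \<mu> k\<close>)
  qed
  show "0 \<le> \<mu> k" by (rule \<mu>)
  have S: "pos_semidef S"
    unfolding pos_semidef_iff S_def inner_rank_one_sum
    by (auto intro!: sum_nonneg simp: hermitian_rank_one_sum \<mu>)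
  have col: "S *v ?u k = sqrt (\<mu> k) *\<^sub>R ?u k" for k
  proof -
    have "(S *v ?u k) $ i = (\<Sum>l\<in>UNIV. if l = k then complex_of_real (sqrt (\<mu> l)) * U l i else 0)" for i
      unfolding S_def rank_one_sum_mult_vec on by (intro sum.cong) auto
    then show ?thesis by (simp add: vec_eq_iff scaleR_complex)
  qed
  have "(S ** S) $ i $ j = M $ i $ j" for i j
  proof -
    have "(S ** S) $ i $ j = (\<Sum>l\<in>UNIV. S $ i $ l * (\<Sum>k\<in>UNIV. complex_of_real (sqrt (\<mu> k)) * U k l * cnj (U k j)))"
      by (simp add: matrix_matrix_mult_def) (simp add: S_def rank_one_sum_def)
    also have "\<dots> = (\<Sum>k\<in>UNIV. complex_of_real (sqrt (\<mu> k)) * cnj (U k j) * (S *v ?u k) $ i)"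
      unfolding matrix_vector_mult_def sum_distrib_left
      by (subst sum.swap) (simp add: mult_ac sum_distrib_left)
    also have "\<dots> = (\<Sum>k\<in>UNIV. complex_of_real (sqrt (\<mu> k) * sqrt (\<mu> k)) * U k i * cnj (U k j))"
      unfolding col of_real_mult by (simp add: scaleR_complex mult_ac)
    also have "\<dots> = M $ i $ j"
      using eigenbasis_entry[OF eb finite UNIV_I UNIV_I, of i j] \<mu>
      by (simp del: of_real_mult)
    finally show ?thesis .
  qed
  then have SS: "S ** S = M" by (simp add: vec_eq_iff)
  show "psd_sqrt M = rank_one_sum (\<lambda>k. sqrt (\<mu> k)) ?u"
    unfolding S_def[symmetric] psd_sqrt_def
    using S SS psd_square_root_unique by (intro the_equality) auto
qed

text \<open>
  Let \<open>u k\<close> be orthonormal eigenvectors of \<open>a a\<^sup>*\<close> with eigenvalues \<open>\<sigma> k\<^sup>2\<close>, and put \<open>w k = a\<^sup>* u k\<close>, a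
  vector of norm \<open>\<sigma> k\<close>. Then \<open>P = \<Sum>k. \<sigma> k u k (u k)\<^sup>*\<close>, and \<open>Q = \<Sum>k. \<sigma> k\<^sup>-\<^sup>1 w k (w k)\<^sup>*\<close> (which is
  \<open>(a\<^sup>* a)\<^sup>1\<^sup>/\<^sup>2\<close>) has the same trace. Expanding \<open>\<langle>x, a y\<rangle>\<close> in the basis \<open>u\<close>, the inequality follows
  term by term from \<open>2 c s \<le> \<sigma> c\<^sup>2 + s\<^sup>2 / \<sigma>\<close>.
\<close>
lemma psd_sqrt_gram_dominates:
  fixes a :: "complex^'n^'n"
  defines "P \<equiv> psd_sqrt (a ** conj_transpose a)"
  obtains Q where "hermitian P" "hermitian Q" "trace Q = trace P"
    "\<And>x y. \<bar>2 * inner x (a *v y)\<bar> \<le> inner x (P *v x) + inner y (Q *v y)"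
proof -
  let ?G = "a ** conj_transpose a"
  obtain U \<mu> where eb: "eigenbasis UNIV (mat_fun ?G) U \<mu>"
    using hermitian_on_eigenbasis[of UNIV "mat_fun ?G"] pos_semidef_gram[of a]
    by (auto simp: hermitian_iff pos_semidef_iff)
  define u where "u k = (\<chi> i. U k i)" for k
  have \<mu>: "0 \<le> \<mu> k" for k using psd_sqrt_spectral(1)[OF pos_semidef_gram eb] .
  define \<sigma> where "\<sigma> k = sqrt (\<mu> k)" for k
  have \<sigma>: "0 \<le> \<sigma> k" "(\<sigma> k)\<^sup>2 = \<mu> k" for k using \<mu>[of k] by (auto simp: \<sigma>_def)
  have P: "P = rank_one_sum \<sigma> u"
    unfolding P_def u_def \<sigma>_def by (rule psd_sqrt_spectral(2)[OF pos_semidef_gram eb])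
  have on: "cvec_inner (u k) (u l) = (if k = l then 1 else 0)" for k l
    using eb by (simp add: eigenbasis_def cinner_on_def u_def)
  have Gu: "?G *v u k = \<mu> k *\<^sub>R u k" for k
  proof -
    have "apply_on UNIV (mat_fun ?G) (U k) i = complex_of_real (\<mu> k) * U k i" for i
      using eb unfolding eigenbasis_def by blast
    then show ?thesis
      by (simp add: u_def vec_eq_iff matrix_vector_mult_def apply_on_def scaleR_complex)
  qed
  define w where "w k = conj_transpose a *v u k" for k
  have ww: "cvec_inner (w k) (w k) = complex_of_real (\<mu> k)" for k
  proof -
    have "cvec_inner (w k) (w k) = cvec_inner (u k) (?G *v u k)"
      unfolding w_def by (simp add: cvec_inner_adjoint[symmetric] matrix_vector_mul_assoc)
    also have "\<dots> = complex_of_real (\<mu> k) * cvec_inner (u k) (u k)"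
      unfolding Gu cinner_on_def by (simp add: scaleR_complex sum_distrib_left mult_ac)
    finally show ?thesis by (simp add: on)
  qed
  \<comment> \<open>For \<open>\<sigma> k = 0\<close> the vector \<open>w k\<close> vanishes, and \<open>inverse 0 = 0\<close> drops the term.\<close>
  define Q where "Q = rank_one_sum (\<lambda>k. inverse (\<sigma> k)) w"
  have "complex_of_real (inverse (\<sigma> k)) * complex_of_real (\<mu> k) = complex_of_real (\<sigma> k)" for k
    unfolding \<sigma>(2)[symmetric] of_real_mult[symmetric] of_real_eq_iff
    by (cases "\<sigma> k = 0") (simp_all add: power2_eq_square)
  then have tr: "trace Q = trace P"
    by (simp add: P Q_def trace_rank_one_sum on ww)
  have dom: "\<bar>2 * inner x (a *v y)\<bar> \<le> inner x (P *v x) + inner y (Q *v y)" for x y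
  proof -
    have "cvec_inner x (a *v y) = cinner_on UNIV (($) x) (\<lambda>i. \<Sum>k\<in>UNIV. cvec_inner (u k) (a *v y) * u k $ i)"
    proof (rule cinner_on_cong)
      fix i
      have "(a *v y) $ i = (\<Sum>k\<in>UNIV. cinner_on UNIV (U k) (($) (a *v y)) * U k i)"
        by (rule eigenbasis_expansion[OF eb finite UNIV_I])
      then show "(a *v y) $ i = (\<Sum>k\<in>UNIV. cvec_inner (u k) (a *v y) * u k $ i)"
        by (simp only: u_def cinner_on_def vec_lambda_beta)
    qed simp
    also have "\<dots> = (\<Sum>k\<in>UNIV. cvec_inner (w k) y * cnj (cvec_inner (u k) x))"
      unfolding cinner_on_sum_right w_def cvec_inner_adjoint
      by (simp add: cinner_on_commute[of UNIV "($) x"])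
    finally have "\<bar>inner x (a *v y)\<bar> \<le> cmod (\<Sum>k\<in>UNIV. cvec_inner (w k) y * cnj (cvec_inner (u k) x))"
      by (simp only: inner_vec_cvec_inner abs_Re_le_cmod)
    also have "\<dots> \<le> (\<Sum>k\<in>UNIV. cmod (cvec_inner (w k) y) * cmod (cvec_inner (u k) x))"
      by (rule order_trans[OF norm_sum]) (simp add: norm_mult)
    finally have "\<bar>2 * inner x (a *v y)\<bar> \<le> (\<Sum>k\<in>UNIV. 2 * (cmod (cvec_inner (w k) y) * cmod (cvec_inner (u k) x)))"
      by (simp add: sum_distrib_left[symmetric] abs_mult)
    also have "\<dots> \<le> (\<Sum>k\<in>UNIV. \<sigma> k * (cmod (cvec_inner (u k) x))\<^sup>2 + inverse (\<sigma> k) * (cmod (cvec_inner (w k) y))\<^sup>2)"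
    proof (rule sum_mono)
      fix k
      let ?c = "cmod (cvec_inner (u k) x)" and ?s = "cmod (cvec_inner (w k) y)"
      show "2 * (?s * ?c) \<le> \<sigma> k * ?c\<^sup>2 + inverse (\<sigma> k) * ?s\<^sup>2"
      proof (cases "\<sigma> k = 0")
        case True
        then have "\<mu> k = 0" using \<sigma>(2)[of k] by simp
        then have "norm_sq_on UNIV (($) (w k)) = 0"
          using ww[of k] unfolding norm_sq_on_cinner_on[symmetric] of_real_eq_iff by simp
        then have "w k = 0" unfolding norm_vec_norm_sq_on[symmetric] by simp
        then show ?thesis using True by (simp add: cinner_on_def)
      next
        case False
        then have pos: "\<sigma> k > 0" using \<sigma>(1)[of k] by simp
        have "0 \<le> inverse (\<sigma> k) * (\<sigma> k * ?c - ?s)\<^sup>2" using pos by simp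
        also have "\<dots> = \<sigma> k * ?c\<^sup>2 + inverse (\<sigma> k) * ?s\<^sup>2 - 2 * (?s * ?c)"
          using pos by (simp add: field_simps power2_eq_square)
        finally show ?thesis by simp
      qed
    qed
    also have "\<dots> = inner x (P *v x) + inner y (Q *v y)"
      by (simp add: P Q_def inner_rank_one_sum sum.distrib)
    finally show ?thesis .
  qed
  show ?thesis
  proof (rule that[of Q, OF _ _ tr dom])
    show "hermitian P" unfolding P by (rule hermitian_rank_one_sum)
    show "hermitian Q" unfolding Q_def by (rule hermitian_rank_one_sum)
  qed
qed

section \<open>Symmetric operators that are bounded below\<close>

text \<open>
  \<open>\<langle>B (B x), x\<rangle> = |B x|\<^sup>2 \<ge> c\<^sup>2 |x|\<^sup>2\<close>, so \<open>B \<circ> B\<close> is coercive, and as in the Lax--Milgram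
  theorem \<open>u \<mapsto> u - e (B (B u) - y)\<close> is a contraction for small \<open>e\<close>. Its fixed point solves
  \<open>B (B u) = y\<close>.
\<close>
lemma symmetric_bounded_below_surj:
  fixes B :: "'a::{real_inner,complete_space} \<Rightarrow> 'a"
  assumes lin: "bounded_linear B" and sym: "\<And>x y. inner (B x) y = inner x (B y)"
    and c: "c > 0" and below: "\<And>x. c * norm x \<le> norm (B x)"
  shows "surj B"
proof (rule surjI)
  interpret bounded_linear B by (rule lin)
  obtain K0 where K0: "\<And>x. norm (B x) \<le> norm x * K0" using bounded by blast
  define K where "K = max K0 c"
  have K: "K > 0" "c \<le> K" using c by (auto simp: K_def)
  have bK: "norm (B x) \<le> K * norm x" for x
    using order_trans[OF K0[of x] mult_left_mono[of K0 K "norm x"]] by (simp add: K_def mult.commute)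
  define e where "e = 1 / K\<^sup>2"
  define q where "q = sqrt (1 - c\<^sup>2 / K\<^sup>2)"
  have cK: "0 < c\<^sup>2 / K\<^sup>2" "c\<^sup>2 / K\<^sup>2 \<le> 1"
    using c K by (auto simp: power_mono)
  have q: "0 \<le> q" "q < 1" "q\<^sup>2 = 1 - c\<^sup>2 / K\<^sup>2"
    using cK by (auto simp: q_def)
  have contr: "norm (d - e *\<^sub>R B (B d)) \<le> q * norm d" for d
  proof (rule power2_le_imp_le)
    have "(norm (d - e *\<^sub>R B (B d)))\<^sup>2 = (norm d)\<^sup>2 - 2 * e * inner d (B (B d)) + e\<^sup>2 * (norm (B (B d)))\<^sup>2"
      by (simp add: power2_norm_eq_inner inner_diff_left inner_diff_right inner_commute[of "B (B d)" d])
        (simp add: power2_eq_square algebra_simps)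
    also have "inner d (B (B d)) = (norm (B d))\<^sup>2" using sym[of d "B d"] by (simp add: power2_norm_eq_inner)
    also have "e\<^sup>2 * (norm (B (B d)))\<^sup>2 \<le> e\<^sup>2 * (K * norm (B d))\<^sup>2"
      by (intro mult_left_mono power_mono bK) auto
    also have "\<dots> = e * (norm (B d))\<^sup>2"
      using K by (simp add: e_def power_mult_distrib power2_eq_square)
    also have "(norm d)\<^sup>2 - 2 * e * (norm (B d))\<^sup>2 + e * (norm (B d))\<^sup>2 = (norm d)\<^sup>2 - e * (norm (B d))\<^sup>2"
      by simp
    also have "\<dots> \<le> (norm d)\<^sup>2 - e * (c * norm d)\<^sup>2"
      using c by (intro diff_left_mono mult_left_mono power_mono below) (auto simp: e_def)
    also have "\<dots> = (q * norm d)\<^sup>2"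
      by (simp add: power_mult_distrib q(3) e_def left_diff_distrib)
    finally show "(norm (d - e *\<^sub>R B (B d)))\<^sup>2 \<le> (q * norm d)\<^sup>2" by simp
  qed (use q in simp)
  fix y
  define G where "G u = u - e *\<^sub>R (B (B u) - y)" for u
  have "dist (G u) (G v) \<le> q * dist u v" for u v
  proof -
    have "G u - G v = (u - v) - e *\<^sub>R B (B (u - v))" by (simp add: G_def diff algebra_simps)
    then show ?thesis using contr[of "u - v"] by (simp add: dist_norm)
  qed
  then have "\<exists>!u. G u = u" using banach_fix_type[of q G] q by blast
  then obtain u where "G u = u" by blast
  then have "B (B u) = y" using K by (simp add: G_def e_def)
  then have "\<exists>x. B x = y" by blast
  then show "B (SOME x. B x = y) = y" by (rule someI_ex)
qed

section \<open>The Hilbert space of square summable sequences\<close>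

text \<open>
  The Hilbert space is made a type so that the general theory of real inner product spaces applies.
  On complex vectors the real inner product is the real part of the complex one, which is what the
  quadratic forms and the symmetry of the Jacobi operator are expressed by.
\<close>
typedef (overloaded) 'a l2seq = "{f :: int \<Rightarrow> 'a::real_inner. (\<lambda>n. (norm (f n))\<^sup>2) summable_on UNIV}"
  morphisms seq Abs_l2seq
  by (rule exI[of _ "\<lambda>_. 0"]) simp

setup_lifting type_definition_l2seq

lemma summable_norm_sq: "(\<lambda>n. (norm (seq x n))\<^sup>2) summable_on UNIV"
  using seq[of x] by simp

lemma norm_add_sq_le: "(norm (a + b))\<^sup>2 \<le> 2 * (norm a)\<^sup>2 + 2 * (norm b)\<^sup>2" for a b :: "'a::real_inner"
proof -
  have "(norm (a + b))\<^sup>2 + (norm (a - b))\<^sup>2 = 2 * (norm a)\<^sup>2 + 2 * (norm b)\<^sup>2"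
    by (simp add: power2_norm_eq_inner inner_add_left inner_add_right inner_diff_left inner_diff_right)
  then show ?thesis using zero_le_power2[of "norm (a - b)"] by linarith
qed

lemma sq_summable_add:
  fixes f g :: "'i \<Rightarrow> 'a::real_inner"
  assumes "(\<lambda>n. (norm (f n))\<^sup>2) summable_on A" "(\<lambda>n. (norm (g n))\<^sup>2) summable_on A"
  shows "(\<lambda>n. (norm (f n + g n))\<^sup>2) summable_on A"
  by (rule summable_on_comparison_test[where f = "\<lambda>n. 2 * (norm (f n))\<^sup>2 + 2 * (norm (g n))\<^sup>2"])
     (auto intro!: summable_on_add summable_on_cmult_right assms norm_add_sq_le)

lemma sq_summable_scaleR:
  fixes f :: "'i \<Rightarrow> 'a::real_inner"
  assumes "(\<lambda>n. (norm (f n))\<^sup>2) summable_on A"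
  shows "(\<lambda>n. (norm (c *\<^sub>R f n))\<^sup>2) summable_on A"
  using summable_on_cmult_right[OF assms, of "c\<^sup>2"] by (simp add: power_mult_distrib)

lemma summable_inner:
  fixes f g :: "'i \<Rightarrow> 'a::real_inner"
  assumes "(\<lambda>n. (norm (f n))\<^sup>2) summable_on A" "(\<lambda>n. (norm (g n))\<^sup>2) summable_on A"
  shows "(\<lambda>n. inner (f n) (g n)) summable_on A"
proof -
  have "(\<lambda>n. norm (inner (f n) (g n))) summable_on A"
  proof (rule summable_on_comparison_test[where f = "\<lambda>n. (norm (f n))\<^sup>2 + (norm (g n))\<^sup>2"])
    fix n
    have "norm (inner (f n) (g n)) \<le> norm (f n) * norm (g n)"
      using Cauchy_Schwarz_ineq2 by (simp add: real_norm_def)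
    also have "\<dots> \<le> (norm (f n))\<^sup>2 + (norm (g n))\<^sup>2"
      using sum_squares_bound[of "norm (f n)" "norm (g n)"]
        mult_nonneg_nonneg[OF norm_ge_zero norm_ge_zero, of "f n" "g n"] by linarith
    finally show "norm (inner (f n) (g n)) \<le> (norm (f n))\<^sup>2 + (norm (g n))\<^sup>2" .
  qed (auto intro!: summable_on_add assms)
  then show ?thesis by (subst summable_on_iff_abs_summable_on_real)
qed

instantiation l2seq :: (real_inner) real_inner
begin

lift_definition zero_l2seq :: "'a l2seq" is "\<lambda>_. 0" by simp
lift_definition plus_l2seq :: "'a l2seq \<Rightarrow> 'a l2seq \<Rightarrow> 'a l2seq" is "\<lambda>f g n. f n + g n"
  by (simp add: sq_summable_add)
lift_definition uminus_l2seq :: "'a l2seq \<Rightarrow> 'a l2seq" is "\<lambda>f n. - f n" by simp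
lift_definition minus_l2seq :: "'a l2seq \<Rightarrow> 'a l2seq \<Rightarrow> 'a l2seq" is "\<lambda>f g n. f n - g n"
proof -
  fix f g :: "int \<Rightarrow> 'a"
  assume "(\<lambda>n. (norm (f n))\<^sup>2) summable_on UNIV" "(\<lambda>n. (norm (g n))\<^sup>2) summable_on UNIV"
  then show "(\<lambda>n. (norm (f n - g n))\<^sup>2) summable_on UNIV"
    using sq_summable_add[of f UNIV "\<lambda>n. - g n"] by simp
qed
lift_definition scaleR_l2seq :: "real \<Rightarrow> 'a l2seq \<Rightarrow> 'a l2seq" is "\<lambda>c f n. c *\<^sub>R f n"
  using sq_summable_scaleR by blast
lift_definition inner_l2seq :: "'a l2seq \<Rightarrow> 'a l2seq \<Rightarrow> real" is
  "\<lambda>f g. infsum (\<lambda>n. inner (f n) (g n)) UNIV" .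
definition norm_l2seq :: "'a l2seq \<Rightarrow> real" where "norm_l2seq x = sqrt (inner x x)"
definition dist_l2seq :: "'a l2seq \<Rightarrow> 'a l2seq \<Rightarrow> real" where "dist_l2seq x y = norm (x - y)"
definition sgn_l2seq :: "'a l2seq \<Rightarrow> 'a l2seq" where "sgn_l2seq x = scaleR (inverse (norm x)) x"
definition uniformity_l2seq :: "('a l2seq \<times> 'a l2seq) filter" where
  "uniformity_l2seq = (INF e\<in>{0<..}. principal {(x, y). dist x y < e})"
definition open_l2seq :: "'a l2seq set \<Rightarrow> bool" where
  "open_l2seq U \<longleftrightarrow> (\<forall>x\<in>U. \<forall>\<^sub>F (x', y) in uniformity. x' = x \<longrightarrow> y \<in> U)"

instance
proof
  fix x y z :: "'a l2seq" and r s :: real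
  show "x + y + z = x + (y + z)" by transfer (simp add: add.assoc)
  show "x + y = y + x" by transfer (simp add: add.commute)
  show "0 + x = x" by transfer simp
  show "- x + x = 0" by transfer simp
  show "x - y = x + - y" by transfer simp
  show "r *\<^sub>R (x + y) = r *\<^sub>R x + r *\<^sub>R y" by transfer (simp add: scaleR_add_right)
  show "(r + s) *\<^sub>R x = r *\<^sub>R x + s *\<^sub>R x" by transfer (simp add: scaleR_add_left)
  show "r *\<^sub>R s *\<^sub>R x = (r * s) *\<^sub>R x" by transfer simp
  show "1 *\<^sub>R x = x" by transfer simp
  show "inner x y = inner y x" by transfer (simp add: inner_commute)
  show "inner (x + y) z = inner x z + inner y z"
    by transfer (simp add: inner_add_left infsum_add summable_inner)
  show "inner (r *\<^sub>R x) y = r * inner x y"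
    by transfer (simp add: infsum_cmult_right summable_inner)
  show nonneg: "0 \<le> inner x x" by transfer (simp add: infsum_nonneg)
  show "(inner x x = 0) = (x = 0)"
  proof transfer
    fix f :: "int \<Rightarrow> 'a" assume f: "(\<lambda>n. (norm (f n))\<^sup>2) summable_on UNIV"
    show "(infsum (\<lambda>n. inner (f n) (f n)) UNIV = 0) = (f = (\<lambda>_. 0))"
    proof
      assume 0: "infsum (\<lambda>n. inner (f n) (f n)) UNIV = 0"
      have "inner (f n) (f n) \<le> 0" for n
        using finite_sum_le_infsum[OF summable_inner[OF f f], of "{n}"] 0 by simp
      then have "inner (f n) (f n) = 0" for n by (rule antisym) (rule inner_ge_zero)
      then show "f = (\<lambda>_. 0)" by (simp add: fun_eq_iff)
    qed simp
  qed
  show "norm x = sqrt (inner x x)" by (rule norm_l2seq_def)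
  show "dist x y = norm (x - y)" by (rule dist_l2seq_def)
  show "sgn x = scaleR (inverse (norm x)) x" by (rule sgn_l2seq_def)
  show "uniformity = (INF e\<in>{0<..}. principal {(x, y). dist x (y :: 'a l2seq) < e})"
    by (rule uniformity_l2seq_def)
  show "open U \<longleftrightarrow> (\<forall>x\<in>U. \<forall>\<^sub>F (x', y) in uniformity. x' = x \<longrightarrow> y \<in> U)" for U :: "'a l2seq set"
    by (rule open_l2seq_def)
qed

end

lemma l2seq_norm_sq: "(norm x)\<^sup>2 = infsum (\<lambda>n. (norm (seq x n))\<^sup>2) UNIV"
  by (simp add: power2_norm_eq_inner inner_l2seq.rep_eq)

lemma l2seq_norm_coord: "norm (seq x n) \<le> norm x"
proof (rule power2_le_imp_le)
  show "(norm (seq x n))\<^sup>2 \<le> (norm x)\<^sup>2"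
    unfolding l2seq_norm_sq
    using finite_sum_le_infsum[OF summable_norm_sq, of "{n}" x] by simp
qed simp

text \<open>
  A Cauchy sequence converges in each coordinate, and the bounds on finite partial sums pass to
  the limit.
\<close>
instance l2seq :: ("{real_inner,complete_space}") complete_space
proof
  fix X :: "nat \<Rightarrow> 'a l2seq" assume X: "Cauchy X"
  have "convergent (\<lambda>k. seq (X k) n)" for n
  proof (rule Cauchy_convergent, rule CauchyI)
    fix e :: real assume "e > 0"
    then obtain N where N: "\<And>k m. k \<ge> N \<Longrightarrow> m \<ge> N \<Longrightarrow> norm (X k - X m) < e"
      using CauchyD[OF X] by blast
    have "norm (seq (X k) n - seq (X m) n) < e" if "k \<ge> N" "m \<ge> N" for k m
      using le_less_trans[OF l2seq_norm_coord N[OF that], of n] by (simp add: minus_l2seq.rep_eq)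
    then show "\<exists>M. \<forall>m\<ge>M. \<forall>k\<ge>M. norm (seq (X m) n - seq (X k) n) < e" by blast
  qed
  then obtain l where l: "\<And>n. (\<lambda>k. seq (X k) n) \<longlonglongrightarrow> l n" unfolding convergent_def by metis
  have fin: "\<exists>N. \<forall>k\<ge>N. \<forall>F. finite F \<longrightarrow> (\<Sum>n\<in>F. (norm (seq (X k) n - l n))\<^sup>2) \<le> e\<^sup>2" if "e > 0" for e
  proof -
    obtain N where N: "\<And>k m. k \<ge> N \<Longrightarrow> m \<ge> N \<Longrightarrow> norm (X k - X m) < e"
      using CauchyD[OF X \<open>e > 0\<close>] by blast
    have "(\<Sum>n\<in>F. (norm (seq (X k) n - l n))\<^sup>2) \<le> e\<^sup>2" if k: "k \<ge> N" and F: "finite F" for k F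
    proof (rule Lim_bounded)
      show "(\<lambda>m. \<Sum>n\<in>F. (norm (seq (X k) n - seq (X m) n))\<^sup>2) \<longlonglongrightarrow> (\<Sum>n\<in>F. (norm (seq (X k) n - l n))\<^sup>2)"
        by (intro tendsto_intros l)
      show "\<forall>m\<ge>N. (\<Sum>n\<in>F. (norm (seq (X k) n - seq (X m) n))\<^sup>2) \<le> e\<^sup>2"
      proof (intro allI impI)
        fix m assume m: "m \<ge> N"
        have "(\<Sum>n\<in>F. (norm (seq (X k) n - seq (X m) n))\<^sup>2) \<le> (norm (X k - X m))\<^sup>2"
          unfolding l2seq_norm_sq
          using finite_sum_le_infsum[OF summable_norm_sq F, of "X k - X m"] by (simp add: minus_l2seq.rep_eq)
        also have "\<dots> \<le> e\<^sup>2" using N[OF k m] by (intro power_mono) auto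
        finally show "(\<Sum>n\<in>F. (norm (seq (X k) n - seq (X m) n))\<^sup>2) \<le> e\<^sup>2" .
      qed
    qed
    then show ?thesis by blast
  qed
  have sm: "(\<lambda>n. (norm (f n))\<^sup>2) summable_on UNIV"
    if "\<And>F. finite F \<Longrightarrow> (\<Sum>n\<in>F. (norm (f n))\<^sup>2) \<le> b" for f :: "int \<Rightarrow> 'a" and b
    by (intro nonneg_bdd_above_summable_on bdd_aboveI2[where M = b]) (use that in auto)
  obtain N where "\<And>F. finite F \<Longrightarrow> (\<Sum>n\<in>F. (norm (seq (X N) n - l n))\<^sup>2) \<le> 1\<^sup>2"
    using fin[of 1] by auto
  then have "(\<lambda>n. (norm (seq (X N) n - l n))\<^sup>2) summable_on UNIV" by (rule sm)
  then have "(\<lambda>n. (norm (- (seq (X N) n - l n) + seq (X N) n))\<^sup>2) summable_on UNIV"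
    by (intro sq_summable_add summable_norm_sq) (simp add: norm_minus_commute)
  then have l2: "(\<lambda>n. (norm (l n))\<^sup>2) summable_on UNIV" by simp
  define L where "L = Abs_l2seq l"
  have L: "seq L = l" unfolding L_def using l2 by (simp add: Abs_l2seq_inverse)
  have "X \<longlonglongrightarrow> L"
  proof (rule metric_LIMSEQ_I)
    fix e :: real assume e: "e > 0"
    obtain N where N: "\<And>k F. k \<ge> N \<Longrightarrow> finite F \<Longrightarrow> (\<Sum>n\<in>F. (norm (seq (X k) n - l n))\<^sup>2) \<le> (e/2)\<^sup>2"
      using fin[of "e/2"] e by auto
    have "dist (X k) L < e" if "k \<ge> N" for k
    proof -
      have "(norm (X k - L))\<^sup>2 \<le> (e/2)\<^sup>2"
        unfolding l2seq_norm_sq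
        using N[OF that] summable_norm_sq[of "X k - L"]
        by (intro infsum_le_finite_sums) (auto simp: minus_l2seq.rep_eq L)
      then have "norm (X k - L) \<le> e/2" by (rule power2_le_imp_le) (use e in simp)
      then show ?thesis using e by (simp add: dist_norm)
    qed
    then show "\<exists>no. \<forall>k\<ge>no. dist (X k) L < e" by blast
  qed
  then show "convergent X" by (rule convergentI)
qed

section \<open>Shifts and matrix multiplication operators\<close>

definition sq_summable :: "(int \<Rightarrow> 'a::real_normed_vector) \<Rightarrow> bool" where
  "sq_summable f \<longleftrightarrow> (\<lambda>n. (norm (f n))\<^sup>2) summable_on UNIV"

lemma seq_sq_summable: "sq_summable (seq x)"
  using summable_norm_sq by (simp add: sq_summable_def)

lemma seq_Abs: "sq_summable f \<Longrightarrow> seq (Abs_l2seq f) = f"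
  by (simp add: Abs_l2seq_inverse sq_summable_def)

lemma bij_int_shift: "bij_betw (\<lambda>n. n + k) UNIV (UNIV :: int set)"
  by (rule bij_betwI[where g = "\<lambda>n. n - k"]) auto

lift_definition shift :: "int \<Rightarrow> 'a::real_inner l2seq \<Rightarrow> 'a l2seq" is "\<lambda>k f n. f (n + k)"
proof -
  fix k and f :: "int \<Rightarrow> 'a"
  assume "(\<lambda>n. (norm (f n))\<^sup>2) summable_on UNIV"
  then show "(\<lambda>n. (norm (f (n + k)))\<^sup>2) summable_on UNIV"
    using summable_on_reindex_bij_betw[OF bij_int_shift, of "\<lambda>n. (norm (f n))\<^sup>2"] by blast
qed

lemma inner_shift: "inner (shift k x) y = inner x (shift (- k) y)"
proof -
  have "inner (shift k x) y = infsum (\<lambda>n. inner (seq x (n + k)) (seq y ((n + k) + - k))) UNIV"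
    by (simp add: inner_l2seq.rep_eq shift.rep_eq)
  also have "\<dots> = inner x (shift (- k) y)"
    unfolding inner_l2seq.rep_eq shift.rep_eq
    by (rule infsum_reindex_bij_betw[OF bij_int_shift, of "\<lambda>n. inner (seq x n) (seq y (n + - k))" k])
  finally show ?thesis .
qed

lemma shift_bounded_linear: "bounded_linear (shift k)"
proof (rule bounded_linear_intro[where K = 1])
  show "shift k (x + y) = shift k x + shift k y" for x y :: "'a l2seq" by transfer simp
  show "shift k (r *\<^sub>R x) = r *\<^sub>R shift k x" for r and x :: "'a l2seq" by transfer simp
  have "shift (- k) (shift k x) = x" for x :: "'a l2seq" by transfer simp
  then show "norm (shift k x) \<le> norm x * 1" for x :: "'a l2seq"
    by (simp add: norm_eq_sqrt_inner inner_shift)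
qed

definition bounded_family :: "(int \<Rightarrow> complex^'m^'m) \<Rightarrow> bool" where
  "bounded_family M \<longleftrightarrow> (\<exists>K. \<forall>n v. norm (M n *v v) \<le> K * norm v)"

lemma bounded_linear_matrix_complex: "bounded_linear (\<lambda>v. A *v v)" for A :: "complex^'n^'m"
proof -
  have "linear (\<lambda>v. A *v v)"
    by (rule linearI) (simp_all add: matrix_vector_right_distrib matrix_vector_mult_scaleR_complex)
  then show ?thesis by (simp add: linear_conv_bounded_linear)
qed

lemma periodic_mult:
  fixes f :: "int \<Rightarrow> 'a"
  assumes "\<And>n. f (n + int p) = f n"
  shows "f (n + k * int p) = f n"
proof (induction k rule: int_induct[of _ 0])
  case (step1 i)
  then show ?case using assms[of "n + i * int p"] by (simp add: algebra_simps)
next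
  case (step2 i)
  then show ?case using assms[of "n + (i - 1) * int p"] by (simp add: algebra_simps)
qed simp

lemma periodic_range:
  fixes f :: "int \<Rightarrow> 'a"
  assumes p: "p \<ge> 1" and per: "\<And>n. f (n + int p) = f n"
  shows "range f = f ` {0..<int p}"
proof -
  have "f n = f (n mod int p)" for n
    using periodic_mult[of f p "n mod int p" "n div int p", OF per] by (simp add: mod_mult_div_eq mult.commute)
  moreover have "n mod int p \<in> {0..<int p}" for n using p by simp
  ultimately show ?thesis by blast
qed

lemma periodic_bounded_family:
  fixes M :: "int \<Rightarrow> complex^'m^'m"
  assumes p: "p \<ge> 1" and per: "\<And>n. M (n + int p) = M n"
  shows "bounded_family M"
proof -
  have fin: "finite (range M)" by (subst periodic_range[of p M, OF p per]) simp_all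
  have "\<exists>K. \<forall>v. norm (A *v v) \<le> K * norm v" for A :: "complex^'m^'m"
    using bounded_linear.bounded[OF bounded_linear_matrix_complex[of A]] by (auto simp: mult.commute)
  then obtain K where K: "\<And>(A::complex^'m^'m) v. norm (A *v v) \<le> K A * norm v" by metis
  show ?thesis
    unfolding bounded_family_def
  proof (intro exI allI)
    fix n v
    have "K (M n) \<le> Max (K ` range M)" using fin by (intro Max_ge) auto
    then show "norm (M n *v v) \<le> Max (K ` range M) * norm v"
      using K[of "M n" v] by (meson mult_right_mono norm_ge_zero order_trans)
  qed
qed

definition mat_op :: "(int \<Rightarrow> complex^'m^'m) \<Rightarrow> (complex^'m) l2seq \<Rightarrow> (complex^'m) l2seq" where
  "mat_op M x = Abs_l2seq (\<lambda>n. M n *v seq x n)"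

lemma seq_mat_op:
  assumes "bounded_family M"
  shows "seq (mat_op M x) n = M n *v seq x n"
proof -
  obtain K where K: "\<And>n v. norm (M n *v v) \<le> K * norm v"
    using assms unfolding bounded_family_def by blast
  have "sq_summable (\<lambda>n. M n *v seq x n)"
    unfolding sq_summable_def
  proof (rule summable_on_comparison_test)
    show "(\<lambda>n. K\<^sup>2 * (norm (seq x n))\<^sup>2) summable_on UNIV"
      by (intro summable_on_cmult_right summable_norm_sq)
    show "(norm (M n *v seq x n))\<^sup>2 \<le> K\<^sup>2 * (norm (seq x n))\<^sup>2" for n
      using power_mono[OF K[of n "seq x n"], of 2] by (simp add: power_mult_distrib)
  qed simp
  then show ?thesis by (simp add: mat_op_def seq_Abs)
qed

lemma l2seq_eqI: "(\<And>n. seq x n = seq y n) \<Longrightarrow> x = y"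
  by (metis ext seq_inject)

lemma mat_op_bounded_linear:
  assumes M: "bounded_family M"
  shows "bounded_linear (mat_op M)"
proof -
  obtain K where K: "\<And>n v. norm (M n *v v) \<le> K * norm v"
    using M unfolding bounded_family_def by blast
  show ?thesis
  proof (rule bounded_linear_intro[where K = "\<bar>K\<bar>"])
    show "mat_op M (x + y) = mat_op M x + mat_op M y" for x y
      by (rule l2seq_eqI) (simp add: seq_mat_op[OF M] plus_l2seq.rep_eq matrix_vector_right_distrib)
    show "mat_op M (r *\<^sub>R x) = r *\<^sub>R mat_op M x" for r x
      by (rule l2seq_eqI) (simp add: seq_mat_op[OF M] scaleR_l2seq.rep_eq matrix_vector_mult_scaleR_complex)
    show "norm (mat_op M x) \<le> norm x * \<bar>K\<bar>" for x
    proof (rule power2_le_imp_le)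
      have "(norm (mat_op M x))\<^sup>2 \<le> infsum (\<lambda>n. K\<^sup>2 * (norm (seq x n))\<^sup>2) UNIV"
        unfolding l2seq_norm_sq
      proof (rule infsum_mono)
        show "(norm (seq (mat_op M x) n))\<^sup>2 \<le> K\<^sup>2 * (norm (seq x n))\<^sup>2" for n
          using power_mono[OF K[of n "seq x n"], of 2] by (simp add: power_mult_distrib seq_mat_op[OF M])
      qed (intro summable_norm_sq summable_on_cmult_right)+
      also have "\<dots> = (norm x * \<bar>K\<bar>)\<^sup>2"
        by (simp add: infsum_cmult_right summable_norm_sq l2seq_norm_sq power_mult_distrib mult.commute)
      finally show "(norm (mat_op M x))\<^sup>2 \<le> (norm x * \<bar>K\<bar>)\<^sup>2" .
    qed simp
  qed
qed

lemma inner_mat_op: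
  assumes "bounded_family M" "bounded_family (\<lambda>n. conj_transpose (M n))"
  shows "inner (mat_op M x) y = inner x (mat_op (\<lambda>n. conj_transpose (M n)) y)"
  unfolding inner_l2seq.rep_eq seq_mat_op[OF assms(1)] seq_mat_op[OF assms(2)]
  by (simp add: inner_adjoint)

section \<open>Summation over cells of one period\<close>

lemma cell_bij:
  assumes p: "p \<ge> 1"
  shows "bij_betw (\<lambda>(k, j). c + k * int p + int j) (UNIV \<times> {..<p}) UNIV"
proof (rule bij_betwI[where g = "\<lambda>n. ((n - c) div int p, nat ((n - c) mod int p))"])
  show "(\<lambda>n. ((n - c) div int p, nat ((n - c) mod int p))) \<in> UNIV \<rightarrow> UNIV \<times> {..<p}"
    using p by (auto simp: nat_less_iff)
  show "(\<lambda>n. ((n - c) div int p, nat ((n - c) mod int p))) ((\<lambda>(k, j). c + k * int p + int j) q) = q"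
    if "q \<in> UNIV \<times> {..<p}" for q
    using that p by (auto simp: add.assoc)
  show "(\<lambda>(k, j). c + k * int p + int j) ((n - c) div int p, nat ((n - c) mod int p)) = n" for n
    using p by (simp add: add.assoc)
qed auto

lemma cell_sums:
  fixes f :: "int \<Rightarrow> real"
  assumes p: "p \<ge> 1" and f: "f summable_on UNIV"
  shows "(\<lambda>k. \<Sum>j<p. f (c + k * int p + int j)) summable_on UNIV"
    and "infsum (\<lambda>k. \<Sum>j<p. f (c + k * int p + int j)) UNIV = infsum f UNIV"
proof -
  have s: "(\<lambda>(k, j). f (c + k * int p + int j)) summable_on (UNIV \<times> {..<p})"
    using summable_on_reindex_bij_betw[OF cell_bij[OF p, of c], of f] f by (simp add: case_prod_beta')
  show "(\<lambda>k. \<Sum>j<p. f (c + k * int p + int j)) summable_on UNIV"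
    using summable_on_Sigma_banach[OF s] by simp
  have "infsum (\<lambda>k. \<Sum>j<p. f (c + k * int p + int j)) UNIV =
      infsum (\<lambda>(k, j). f (c + k * int p + int j)) (UNIV \<times> {..<p})"
    using infsum_Sigma'_banach[OF s] by simp
  also have "\<dots> = infsum f UNIV"
    using infsum_reindex_bij_betw[OF cell_bij[OF p, of c], of f] by (simp add: case_prod_beta')
  finally show "infsum (\<lambda>k. \<Sum>j<p. f (c + k * int p + int j)) UNIV = infsum f UNIV" .
qed

lemma summable_if_cell_sums_summable:
  fixes f :: "int \<Rightarrow> real"
  assumes p: "p \<ge> 1" and nonneg: "\<And>n. f n \<ge> 0"
    and cells: "(\<lambda>k. \<Sum>j<p. f (c + k * int p + int j)) summable_on UNIV"
  shows "f summable_on UNIV"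
proof -
  have "(\<lambda>q. f (case q of (k, j) \<Rightarrow> c + k * int p + int j)) summable_on (UNIV \<times> {..<p})"
    by (rule summable_on_SigmaI[OF _ cells]) (auto simp: nonneg)
  then show ?thesis using summable_on_reindex_bij_betw[OF cell_bij[OF p, of c], of f] by simp
qed

text \<open>
  The boundary terms \<open>t\<close> of neighbouring cells cancel after summation over all cells.
\<close>
lemma infsum_telescope_le:
  fixes H N t :: "int \<Rightarrow> real"
  assumes H: "H summable_on UNIV" and N: "N summable_on UNIV" and t: "t summable_on UNIV"
    and le: "\<And>k. y * N k + t k - t (k + 1) \<le> H k"
  shows "y * infsum N UNIV \<le> infsum H UNIV"
proof -
  have t1: "(\<lambda>k. t (k + 1)) summable_on UNIV" "infsum (\<lambda>k. t (k + 1)) UNIV = infsum t UNIV"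
    using summable_on_reindex_bij_betw[OF bij_int_shift, of t 1]
      infsum_reindex_bij_betw[OF bij_int_shift, of t 1] t by auto
  have yN: "(\<lambda>k. y * N k) summable_on UNIV" by (rule summable_on_cmult_right[OF N])
  have "infsum (\<lambda>k. y * N k + t k) UNIV \<le> infsum (\<lambda>k. H k + t (k + 1)) UNIV"
  proof (rule infsum_mono)
    show "y * N k + t k \<le> H k + t (k + 1)" for k using le[of k] by linarith
  qed (intro summable_on_add yN t H t1)+
  then show ?thesis
    by (simp add: infsum_add yN t H t1 infsum_cmult_right N)
qed

section \<open>Matrices of decoupled cells\<close>

text \<open>
  Block \<open>(j, l)\<close> of the matrix of one cell: diagonal blocks \<open>d\<close>, and coupling \<open>a\<close> between
  neighbouring sites within the cell.
\<close>
definition cell_block ::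
  "(nat \<Rightarrow> complex^'m^'m) \<Rightarrow> (nat \<Rightarrow> complex^'m^'m) \<Rightarrow> nat \<Rightarrow> nat \<Rightarrow> complex^'m^'m" where
  "cell_block d a j l =
     (if l = j then d j else 0) + (if l = Suc j then a j else 0) +
     (if j = Suc l then conj_transpose (a l) else 0)"

definition cell_matrix ::
  "(nat \<Rightarrow> complex^'m^'m) \<Rightarrow> (nat \<Rightarrow> complex^'m^'m) \<Rightarrow> nat \<times> 'm \<Rightarrow> nat \<times> 'm \<Rightarrow> complex" where
  "cell_matrix d a = (\<lambda>(j, i) (l, k). cell_block d a j l $ i $ k)"

abbreviation cell_index :: "nat \<Rightarrow> (nat \<times> 'm) set" where
  "cell_index p \<equiv> {..<p} \<times> UNIV"

lemma conj_transpose_add: "conj_transpose (A + B) = conj_transpose A + conj_transpose B"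
  by (simp add: conj_transpose_def vec_eq_iff)

lemma conj_transpose_0 [simp]: "conj_transpose 0 = 0"
  by (simp add: conj_transpose_def vec_eq_iff)

lemma conj_transpose_cell_block:
  assumes "\<And>j. hermitian (d j)"
  shows "conj_transpose (cell_block d a j l) = cell_block d a l j"
  using assms by (auto simp: cell_block_def conj_transpose_add hermitian_def)

lemma sum_cell_index: "sum F (cell_index p) = (\<Sum>j<p. \<Sum>i\<in>UNIV. F (j, i))"
  by (simp add: sum.cartesian_product)

lemma cell_matrix_hermitian:
  fixes d a :: "nat \<Rightarrow> complex^'m^'m"
  assumes "\<And>j. hermitian (d j)"
  shows "hermitian_on (cell_index p) (cell_matrix d a)"
  unfolding hermitian_on_def
proof (intro ballI)
  fix q r :: "nat \<times> 'm"
  obtain j i l k where qr: "q = (j, i)" "r = (l, k)" by (cases q, cases r)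
  have "cell_block d a l j $ k $ i = cnj (cell_block d a j l $ i $ k)"
    unfolding conj_transpose_cell_block[OF assms, where a = a and j = j and l = l, symmetric] by (simp add: conj_transpose_def)
  then show "cell_matrix d a r q = cnj (cell_matrix d a q r)"
    by (simp add: cell_matrix_def qr)
qed

lemma cell_matrix_quad_form_on:
  fixes f :: "nat \<times> 'm::finite \<Rightarrow> complex"
  defines "g \<equiv> \<lambda>j. \<chi> i. f (j, i)"
  shows "quad_form_on (cell_index p) (cell_matrix d a) f =
    (\<Sum>j<p. inner (g j) (d j *v g j)) + 2 * (\<Sum>j<p. if Suc j < p then inner (g j) (a j *v g (Suc j)) else 0)"
proof -
  have apply_on: "apply_on (cell_index p) (cell_matrix d a) f (j, i) = (\<Sum>l<p. (cell_block d a j l *v g l) $ i)" for j i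
    by (simp add: apply_on_def cell_matrix_def g_def matrix_vector_mult_def sum_cell_index)
  have "quad_form_on (cell_index p) (cell_matrix d a) f = (\<Sum>j<p. \<Sum>l<p. inner (g j) (cell_block d a j l *v g l))"
  proof -
    have "cinner_on (cell_index p) f (apply_on (cell_index p) (cell_matrix d a) f) =
        (\<Sum>j<p. \<Sum>i\<in>UNIV. cnj (g j $ i) * (\<Sum>l<p. (cell_block d a j l *v g l) $ i))"
      unfolding cinner_on_def by (simp add: sum_cell_index apply_on g_def)
    also have "\<dots> = (\<Sum>j<p. \<Sum>l<p. cvec_inner (g j) (cell_block d a j l *v g l))"
      unfolding cinner_on_def sum_distrib_left by (intro sum.cong refl sum.swap)
    finally show ?thesis by (simp add: quad_form_on_def inner_vec_cvec_inner)
  qed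
  also have "\<dots> = (\<Sum>j<p. \<Sum>l<p. (if l = j then inner (g j) (d j *v g l) else 0) +
      (if l = Suc j then inner (g j) (a j *v g l) else 0) +
      (if j = Suc l then inner (g j) (conj_transpose (a l) *v g l) else 0))"
    by (intro sum.cong refl)
       (simp add: cell_block_def matrix_vector_mult_add_rdistrib inner_add_right)
  also have "\<dots> = (\<Sum>j<p. \<Sum>l<p. if l = j then inner (g j) (d j *v g l) else 0) +
      (\<Sum>j<p. \<Sum>l<p. if l = Suc j then inner (g j) (a j *v g l) else 0) +
      (\<Sum>j<p. \<Sum>l<p. if j = Suc l then inner (g j) (conj_transpose (a l) *v g l) else 0)"
    by (simp only: sum.distrib)
  also have "(\<Sum>j<p. \<Sum>l<p. if l = j then inner (g j) (d j *v g l) else 0) = (\<Sum>j<p. inner (g j) (d j *v g j))"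
    by (intro sum.cong refl) simp
  also have "(\<Sum>j<p. \<Sum>l<p. if l = Suc j then inner (g j) (a j *v g l) else 0) =
      (\<Sum>j<p. if Suc j < p then inner (g j) (a j *v g (Suc j)) else 0)"
    by (intro sum.cong refl) simp
  also have "(\<Sum>j<p. \<Sum>l<p. if j = Suc l then inner (g j) (conj_transpose (a l) *v g l) else 0) =
      (\<Sum>l<p. if Suc l < p then inner (g l) (a l *v g (Suc l)) else 0)"
  proof -
    have "(\<Sum>j<p. \<Sum>l<p. if j = Suc l then inner (g j) (conj_transpose (a l) *v g l) else 0) =
        (\<Sum>l<p. \<Sum>j<p. if j = Suc l then inner (g j) (conj_transpose (a l) *v g l) else 0)"
      by (rule sum.swap)
    also have "\<dots> = (\<Sum>l<p. if Suc l < p then inner (g (Suc l)) (conj_transpose (a l) *v g l) else 0)"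
      by (intro sum.cong refl) simp
    also have "\<dots> = (\<Sum>l<p. if Suc l < p then inner (g l) (a l *v g (Suc l)) else 0)"
      by (intro sum.cong refl) (simp add: inner_adjoint[of "g _" "a _"] inner_commute)
    finally show ?thesis .
  qed
  finally show ?thesis by simp
qed

lemma cell_matrix_trace:
  "(\<Sum>q\<in>cell_index p. cell_matrix d a q q) = (\<Sum>j<p. trace (d j))"
  by (simp add: sum_cell_index cell_matrix_def cell_block_def trace_def)

text \<open>
  The matrices that stand in for the cut bonds: \<open>P\<close> at the last site of the cell, which is the left
  end of a cut bond, and \<open>Q\<close> at the first site, which is the right end of the previous one. Both sites
  coincide when \<open>p = 1\<close>.
\<close>
definition with_boundary ::
  "nat \<Rightarrow> complex^'m^'m \<Rightarrow> complex^'m^'m \<Rightarrow> real \<Rightarrow> (nat \<Rightarrow> complex^'m^'m) \<Rightarrow> nat \<Rightarrow> complex^'m^'m" where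
  "with_boundary p P Q s d j =
     d j + (if Suc j = p then s *\<^sub>R P else 0) + (if j = 0 then s *\<^sub>R Q else 0)"

lemma hermitian_scaleR: "hermitian A \<Longrightarrow> hermitian (s *\<^sub>R A)"
  by (simp add: hermitian_def conj_transpose_def vec_eq_iff complex_eq_iff)

lemma hermitian_add: "hermitian A \<Longrightarrow> hermitian B \<Longrightarrow> hermitian (A + B)"
  by (simp add: hermitian_def conj_transpose_add)

lemma hermitian_with_boundary:
  assumes "hermitian P" "hermitian Q" "\<And>j. hermitian (d j)"
  shows "hermitian (with_boundary p P Q s d j)"
proof -
  have "hermitian (0 :: complex^'a^'a)" by (simp add: hermitian_def)
  then show ?thesis unfolding with_boundary_def
    by (auto intro!: hermitian_add hermitian_scaleR assms)
qed

lemma scaleR_matrix_vector_mult: "(s *\<^sub>R A) *v x = s *\<^sub>R (A *v x)" for A :: "complex^'n^'m"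
  by (simp add: vec_eq_iff matrix_vector_mult_def scaleR_sum_right)

lemma sum_with_boundary_inner:
  assumes "p \<ge> 1"
  shows "(\<Sum>j<p. inner (g j) (with_boundary p P Q s d j *v g j)) =
    (\<Sum>j<p. inner (g j) (d j *v g j)) + s * (inner (g (p - 1)) (P *v g (p - 1)) + inner (g 0) (Q *v g 0))"
proof -
  have "(\<Sum>j<p. inner (g j) (with_boundary p P Q s d j *v g j)) =
    (\<Sum>j<p. inner (g j) (d j *v g j) + (if j = p - 1 then s * inner (g j) (P *v g j) else 0) +
       (if j = 0 then s * inner (g j) (Q *v g j) else 0))"
    using assms
    by (intro sum.cong refl)
       (auto simp: with_boundary_def matrix_vector_mult_add_rdistrib inner_add_right scaleR_matrix_vector_mult)
  also have "\<dots> = (\<Sum>j<p. inner (g j) (d j *v g j)) + (s * inner (g (p - 1)) (P *v g (p - 1)) + s * inner (g 0) (Q *v g 0))"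
    using assms by (simp add: sum.distrib)
  finally show ?thesis by (simp add: distrib_left)
qed

lemma trace_scaleR: "trace (s *\<^sub>R A) = complex_of_real s * trace A" for A :: "complex^'n^'n"
  by (simp add: trace_def sum_distrib_left scaleR_complex)

lemma trace_zero: "trace (0 :: complex^'n^'n) = 0"
  by (simp add: trace_def)

lemma sum_with_boundary_trace:
  assumes "p \<ge> 1"
  shows "(\<Sum>j<p. trace (with_boundary p P Q s d j)) =
    (\<Sum>j<p. trace (d j)) + complex_of_real s * (trace P + trace Q)"
proof -
  have "(\<Sum>j<p. trace (with_boundary p P Q s d j)) =
    (\<Sum>j<p. trace (d j) + (if j = p - 1 then complex_of_real s * trace P else 0) +
       (if j = 0 then complex_of_real s * trace Q else 0))"
    using assms by (intro sum.cong refl) (auto simp: with_boundary_def trace_add trace_scaleR trace_zero)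
  also have "\<dots> = (\<Sum>j<p. trace (d j)) + (complex_of_real s * trace P + complex_of_real s * trace Q)"
    using assms by (simp add: sum.distrib)
  finally show ?thesis by (simp add: distrib_left)
qed

section \<open>Comparison of the Jacobi operator with decoupled cells\<close>

text \<open>
  The sum of this density over all sites is \<open>\<langle>J y, y\<rangle>\<close>; each bond is counted at its left end, with the
  two conjugate terms of \<open>J\<close> merged.
\<close>
definition jacobi_density ::
  "(int \<Rightarrow> complex^'m^'m) \<Rightarrow> (int \<Rightarrow> complex^'m^'m) \<Rightarrow> (int \<Rightarrow> complex^'m) \<Rightarrow> int \<Rightarrow> real" where
  "jacobi_density a b y n = inner (y n) (b n *v y n) + 2 * inner (y n) (a n *v y (n + 1))"

definition cell_vec :: "int \<Rightarrow> nat \<Rightarrow> (int \<Rightarrow> complex^'m) \<Rightarrow> int \<Rightarrow> nat \<times> 'm \<Rightarrow> complex" where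
  "cell_vec c p y k = (\<lambda>(j, i). y (c + k * int p + int j) $ i)"

text \<open>
  The matrix of a cell starting at site \<open>c\<close>. For \<open>P\<close> and \<open>Q\<close> that dominate the
  cut bonds, the sum over all cells is above the Jacobi operator for \<open>s = 1\<close> and below it for
  \<open>s = - 1\<close>.
\<close>
definition decoupled ::
  "int \<Rightarrow> nat \<Rightarrow> (int \<Rightarrow> complex^'m^'m) \<Rightarrow> (int \<Rightarrow> complex^'m^'m) \<Rightarrow> complex^'m^'m \<Rightarrow> complex^'m^'m \<Rightarrow>
    real \<Rightarrow> nat \<times> 'm \<Rightarrow> nat \<times> 'm \<Rightarrow> complex" where
  "decoupled c p a b P Q s =
     cell_matrix (with_boundary p P Q s (\<lambda>j. b (c + int j))) (\<lambda>j. a (c + int j))"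

lemma norm_sq_on_cell_vec: "norm_sq_on (cell_index p) (cell_vec c p y k) = (\<Sum>j<p. (norm (y (c + k * int p + int j)))\<^sup>2)"
  unfolding norm_sq_on_def sum_cell_index norm_vec_norm_sq_on by (simp add: cell_vec_def)

text \<open>
  \<open>P\<close> and \<open>Q\<close> are any Hermitian matrices that dominate the bond at \<open>n0\<close>. Cells start at the site \<open>n0 + 1\<close>,
  so that the bonds between different cells are the translates of this one.
\<close>
locale periodic_jacobi =
  fixes a b :: "int \<Rightarrow> complex^'m^'m" and p :: nat and P Q :: "complex^'m^'m" and n0 :: int
  assumes p: "p \<ge> 1"
    and a: "\<And>n. a (n + int p) = a n"
    and b: "\<And>n. b (n + int p) = b n"
    and b_herm: "\<And>n. hermitian (b n)"
    and P_herm: "hermitian P" and Q_herm: "hermitian Q"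
    and dominates: "\<And>x y. \<bar>2 * inner x (a n0 *v y)\<bar> \<le> inner x (P *v x) + inner y (Q *v y)"
begin

abbreviation "c \<equiv> n0 + 1"
abbreviation "D \<equiv> decoupled c p a b P Q"
abbreviation "I \<equiv> cell_index p :: (nat \<times> 'm) set"

lemma decoupled_hermitian: "hermitian_on I (D s)"
  unfolding decoupled_def
  by (intro cell_matrix_hermitian hermitian_with_boundary P_herm Q_herm b_herm)

lemma PQ_nonneg: "0 \<le> inner x (P *v x)" "0 \<le> inner x (Q *v x)"
  using dominates[of x 0] dominates[of 0 x] by simp_all

lemma decoupled_mono: "quad_form_on I (D (-1)) f \<le> quad_form_on I (D 1) f"
proof -
  have "S + (-1) * (A + B) + T \<le> S + 1 * (A + B) + T" if "0 \<le> A" "0 \<le> B" for S A B T :: real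
    by (intro add_mono) (use that in simp_all)
  then show ?thesis
    unfolding decoupled_def cell_matrix_quad_form_on sum_with_boundary_inner[OF p] using PQ_nonneg by blast
qed

lemma decoupled_trace: "(\<Sum>q\<in>I. D 1 q q - D (-1) q q) = 2 * (trace P + trace Q)"
  unfolding decoupled_def sum_subtractf cell_matrix_trace sum_with_boundary_trace[OF p] by simp

text \<open>
  The energy \<open>H k\<close> of a cell includes the cut bond on its right, which is estimated by \<open>P\<close> at the last
  site of the cell and \<open>Q\<close> at the first site of the next cell. The matrix has its \<open>Q\<close> at the first
  site of its own cell instead; the difference of the two is the telescoping term \<open>t k - t (k + 1)\<close>.
\<close>
lemma cell_energy:
  fixes y :: "int \<Rightarrow> complex^'m"
  defines "t \<equiv> \<lambda>k. inner (y (c + k * int p)) (Q *v y (c + k * int p))"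
    and "H \<equiv> \<lambda>k. \<Sum>j<p. jacobi_density a b y (c + k * int p + int j)"
  shows "quad_form_on I (D (-1)) (cell_vec c p y k) + t k - t (k + 1) \<le> H k"
    and "H k \<le> quad_form_on I (D 1) (cell_vec c p y k) - t k + t (k + 1)"
proof -
  define g where "g j = y (c + k * int p + int j)" for j
  have ga: "a (c + k * int p + int j) = a (c + int j)" for j
    using periodic_mult[of a p "c + int j" k, OF a] by (simp add: algebra_simps)
  have gb: "b (c + k * int p + int j) = b (c + int j)" for j
    using periodic_mult[of b p "c + int j" k, OF b] by (simp add: algebra_simps)
  have alast: "a (c + int (p - Suc 0)) = a n0" using a[of n0] p by (simp add: of_nat_diff)
  have gn: "y (c + k * int p + int j + 1) = g (Suc j)" for j by (simp add: g_def algebra_simps)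
  have gp: "g p = y (c + (k + 1) * int p)" by (simp add: g_def algebra_simps)
  let ?S = "\<Sum>j<p. inner (g j) (b (c + int j) *v g j)"
  let ?T = "\<Sum>j<p. if Suc j < p then inner (g j) (a (c + int j) *v g (Suc j)) else 0"
  have H: "H k = ?S + 2 * ?T + 2 * inner (g (p - 1)) (a n0 *v g p)"
  proof -
    have "H k = ?S + 2 * (\<Sum>j<p. inner (g j) (a (c + int j) *v g (Suc j)))"
      unfolding H_def jacobi_density_def ga gb gn g_def[symmetric] sum.distrib sum_distrib_left ..
    also have "(\<Sum>j<p. inner (g j) (a (c + int j) *v g (Suc j))) =
        (\<Sum>j<p. (if Suc j < p then inner (g j) (a (c + int j) *v g (Suc j)) else 0) +
          (if j = p - 1 then inner (g j) (a (c + int j) *v g (Suc j)) else 0))"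
      by (intro sum.cong refl) auto
    also have "\<dots> = ?T + inner (g (p - 1)) (a n0 *v g p)"
      using p by (simp add: sum.distrib alast del: of_nat_diff)
    finally show ?thesis by simp
  qed
  have cell: "(\<chi> i. cell_vec c p y k (j, i)) = g j" for j
    by (simp add: cell_vec_def g_def vec_eq_iff)
  have q: "quad_form_on I (D s) (cell_vec c p y k) =
      ?S + s * (inner (g (p - 1)) (P *v g (p - 1)) + inner (g 0) (Q *v g 0)) + 2 * ?T" for s
    unfolding decoupled_def cell_matrix_quad_form_on sum_with_boundary_inner[OF p] cell ..
  have t: "t k = inner (g 0) (Q *v g 0)" "t (k + 1) = inner (g p) (Q *v g p)"
    unfolding gp by (simp_all add: t_def g_def)
  show "quad_form_on I (D (-1)) (cell_vec c p y k) + t k - t (k + 1) \<le> H k"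
    using dominates[of "g (p - 1)" "g p"] unfolding H q t by (simp add: abs_le_iff)
  show "H k \<le> quad_form_on I (D 1) (cell_vec c p y k) - t k + t (k + 1)"
    using dominates[of "g (p - 1)" "g p"] unfolding H q t by (simp add: abs_le_iff)
qed

lemma bounded: "bounded_family a" "bounded_family b" "bounded_family (\<lambda>n. conj_transpose (a n))"
  by (rule periodic_bounded_family[OF p], simp add: a b)+

definition J :: "(complex^'m) l2seq \<Rightarrow> (complex^'m) l2seq" where
  "J u = mat_op a (shift 1 u) + mat_op b u + shift (-1) (mat_op (\<lambda>n. conj_transpose (a n)) u)"

lemma seq_J: "seq (J u) = jacobi a b (seq u)"
  by (simp add: fun_eq_iff J_def jacobi_def plus_l2seq.rep_eq shift.rep_eq seq_mat_op bounded)

lemma J_bounded_linear: "bounded_linear J"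
  unfolding J_def
  by (intro bounded_linear_add bounded_linear_compose[OF mat_op_bounded_linear shift_bounded_linear]
      bounded_linear_compose[OF shift_bounded_linear mat_op_bounded_linear] mat_op_bounded_linear bounded)

lemma J_symmetric: "inner (J u) v = inner u (J v)"
proof -
  have a1: "inner (mat_op a (shift 1 u)) v = inner u (shift (-1) (mat_op (\<lambda>n. conj_transpose (a n)) v))" for u v
    by (simp add: inner_mat_op bounded inner_shift)
  have b1: "inner (mat_op b u) v = inner u (mat_op b v)"
    using inner_mat_op[of b u v] b_herm bounded by (simp add: hermitian_def)
  have c1: "inner (shift (-1) (mat_op (\<lambda>n. conj_transpose (a n)) u)) v = inner u (mat_op a (shift 1 v))"
    using a1[of v u] by (simp add: inner_commute)
  show ?thesis by (simp add: J_def inner_add_left inner_add_right a1 b1 c1)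
qed

lemma summable_density: "jacobi_density a b (seq u) summable_on UNIV"
  and J_form: "inner (J u) u = infsum (jacobi_density a b (seq u)) UNIV"
proof -
  have s1: "(\<lambda>n. inner (seq u n) (b n *v seq u n)) summable_on UNIV"
    using summable_inner[OF summable_norm_sq[of u] summable_norm_sq[of "mat_op b u"]]
    by (simp add: seq_mat_op bounded)
  have s2: "(\<lambda>n. inner (seq u n) (a n *v seq u (n + 1))) summable_on UNIV"
    using summable_inner[OF summable_norm_sq[of u] summable_norm_sq[of "mat_op a (shift 1 u)"]]
    by (simp add: seq_mat_op bounded shift.rep_eq)
  show "jacobi_density a b (seq u) summable_on UNIV"
    unfolding jacobi_density_def by (intro summable_on_add s1 summable_on_cmult_right s2)
  have "inner (shift (-1) (mat_op (\<lambda>n. conj_transpose (a n)) u)) u = inner (mat_op a (shift 1 u)) u"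
    by (simp add: inner_shift[of "-1"] inner_mat_op[of a] bounded inner_commute[of "shift 1 u"])
  then have "inner (J u) u = inner u (mat_op b u) + 2 * inner u (mat_op a (shift 1 u))"
    by (simp add: J_def inner_add_left inner_commute[of "mat_op _ _" u])
  also have "\<dots> = infsum (jacobi_density a b (seq u)) UNIV"
    unfolding jacobi_density_def
    by (simp add: inner_l2seq.rep_eq seq_mat_op bounded shift.rep_eq infsum_add s1 s2
        summable_on_cmult_right infsum_cmult_right)
  finally show "inner (J u) u = infsum (jacobi_density a b (seq u)) UNIV" .
qed

lemma summable_boundary:
  "(\<lambda>k. inner (seq u (c + k * int p)) (Q *v seq u (c + k * int p))) summable_on UNIV"
proof -
  have "bounded_family (\<lambda>_. Q)" by (rule periodic_bounded_family[OF p refl])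
  then have "(\<lambda>n. inner (seq u n) (Q *v seq u n)) summable_on UNIV"
    using summable_inner[OF summable_norm_sq[of u] summable_norm_sq[of "mat_op (\<lambda>_. Q) u"]]
    by (simp add: seq_mat_op)
  then have "(\<lambda>n. inner (seq u n) (Q *v seq u n)) summable_on range (\<lambda>k. c + k * int p)"
    by (rule summable_on_subset_banach) simp
  moreover have "inj (\<lambda>k. c + k * int p)" using p by (auto simp: inj_on_def)
  ultimately show ?thesis by (simp add: summable_on_reindex o_def)
qed

lemma J_lower:
  assumes "\<And>k. y * norm_sq_on I (cell_vec c p (seq u) k) \<le> quad_form_on I (D (-1)) (cell_vec c p (seq u) k)"
  shows "y * (norm u)\<^sup>2 \<le> inner (J u) u"
proof -
  have "y * infsum (\<lambda>k. \<Sum>j<p. (norm (seq u (c + k * int p + int j)))\<^sup>2) UNIV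
      \<le> infsum (\<lambda>k. \<Sum>j<p. jacobi_density a b (seq u) (c + k * int p + int j)) UNIV"
  proof (rule infsum_telescope_le[OF cell_sums(1)[OF p summable_density]
        cell_sums(1)[OF p summable_norm_sq] summable_boundary])
    show "y * (\<Sum>j<p. (norm (seq u (c + k * int p + int j)))\<^sup>2) +
        inner (seq u (c + k * int p)) (Q *v seq u (c + k * int p)) -
        inner (seq u (c + (k + 1) * int p)) (Q *v seq u (c + (k + 1) * int p))
        \<le> (\<Sum>j<p. jacobi_density a b (seq u) (c + k * int p + int j))" for k
      using cell_energy(1)[of "seq u" k] assms[of k] unfolding norm_sq_on_cell_vec by linarith
  qed
  then show ?thesis
    unfolding cell_sums(2)[OF p summable_density] cell_sums(2)[OF p summable_norm_sq]
      J_form l2seq_norm_sq .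
qed

lemma J_upper:
  assumes "\<And>k. quad_form_on I (D 1) (cell_vec c p (seq u) k) \<le> y * norm_sq_on I (cell_vec c p (seq u) k)"
  shows "inner (J u) u \<le> y * (norm u)\<^sup>2"
proof -
  have "(- y) * infsum (\<lambda>k. \<Sum>j<p. (norm (seq u (c + k * int p + int j)))\<^sup>2) UNIV
      \<le> infsum (\<lambda>k. - (\<Sum>j<p. jacobi_density a b (seq u) (c + k * int p + int j))) UNIV"
  proof (rule infsum_telescope_le[OF _ cell_sums(1)[OF p summable_norm_sq] summable_boundary])
    show "(\<lambda>k. - (\<Sum>j<p. jacobi_density a b (seq u) (c + k * int p + int j))) summable_on UNIV"
      by (intro summable_on_uminus[THEN iffD2] cell_sums(1)[OF p summable_density])
    show "- y * (\<Sum>j<p. (norm (seq u (c + k * int p + int j)))\<^sup>2) +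
        inner (seq u (c + k * int p)) (Q *v seq u (c + k * int p)) -
        inner (seq u (c + (k + 1) * int p)) (Q *v seq u (c + (k + 1) * int p))
        \<le> - (\<Sum>j<p. jacobi_density a b (seq u) (c + k * int p + int j))" for k
      using cell_energy(2)[of "seq u" k] assms[of k] unfolding norm_sq_on_cell_vec by linarith
  qed
  then show ?thesis
    unfolding infsum_uminus cell_sums(2)[OF p summable_density] cell_sums(2)[OF p summable_norm_sq]
      J_form l2seq_norm_sq by simp
qed

text \<open>The uniform bound by the cells of \<open>u\<close> makes the assembled sequence square summable.\<close>
lemma assemble_cells:
  assumes le: "\<And>k. norm_sq_on I (V k) \<le> C * norm_sq_on I (cell_vec c p (seq u) k)"
  obtains v where "\<And>k q. q \<in> I \<Longrightarrow> cell_vec c p (seq v) k q = V k q"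
proof -
  define f where "f n = (\<chi> i. V ((n - c) div int p) (nat ((n - c) mod int p), i))" for n
  have f: "f (c + k * int p + int j) = (\<chi> i. V k (j, i))" if "j < p" for k j
    using that p by (simp add: f_def add.assoc)
  have N: "(\<Sum>j<p. (norm (f (c + k * int p + int j)))\<^sup>2) = norm_sq_on I (V k)" for k
    unfolding norm_sq_on_def sum_cell_index norm_vec_norm_sq_on using f by simp
  have "(\<lambda>n. (norm (f n))\<^sup>2) summable_on UNIV"
  proof (rule summable_if_cell_sums_summable[OF p, of _ c])
    show "(\<lambda>k. \<Sum>j<p. (norm (f (c + k * int p + int j)))\<^sup>2) summable_on UNIV"
      unfolding N
    proof (rule summable_on_comparison_test)
      show "(\<lambda>k. C * (\<Sum>j<p. (norm (seq u (c + k * int p + int j)))\<^sup>2)) summable_on UNIV"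
        by (intro summable_on_cmult_right cell_sums(1)[OF p summable_norm_sq])
      show "norm_sq_on I (V k) \<le> C * (\<Sum>j<p. (norm (seq u (c + k * int p + int j)))\<^sup>2)" for k
        using le[of k] by (simp add: norm_sq_on_cell_vec)
    qed (rule norm_sq_on_nonneg)
  qed simp
  then have "seq (Abs_l2seq f) = f" by (simp add: Abs_l2seq_inverse)
  then show ?thesis using f by (intro that[of "Abs_l2seq f"]) (auto simp: cell_vec_def)
qed

text \<open>
  Test \<open>(J - x) u\<close>, where \<open>u = v + w\<close>, against \<open>w - v\<close>: by symmetry the mixed terms cancel, and the two
  remaining ones are both bounded below.
\<close>
lemma J_bounded_below:
  assumes "splits_at I (D (-1)) (D 1) x"
  obtains \<epsilon> where "\<epsilon> > 0" "\<And>u. \<epsilon> * norm u \<le> norm (J u - x *\<^sub>R u)"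
proof -
  obtain \<delta> C where \<delta>: "\<delta> > 0" and split: "\<And>f. \<exists>v w.
      (\<forall>i\<in>I. f i = v i + w i) \<and> norm_sq_on I v \<le> C * norm_sq_on I f \<and> norm_sq_on I w \<le> C * norm_sq_on I f \<and>
      quad_form_on I (D 1) v \<le> (x - \<delta>) * norm_sq_on I v \<and> (x + \<delta>) * norm_sq_on I w \<le> quad_form_on I (D (-1)) w"
    using assms unfolding splits_at_def by blast
  have "\<delta> / 2 * norm u \<le> norm (J u - x *\<^sub>R u)" for u
  proof -
    let ?f = "cell_vec c p (seq u)"
    have "\<forall>k. \<exists>v w. (\<forall>i\<in>I. ?f k i = v i + w i) \<and> norm_sq_on I v \<le> C * norm_sq_on I (?f k) \<and>
        norm_sq_on I w \<le> C * norm_sq_on I (?f k) \<and> quad_form_on I (D 1) v \<le> (x - \<delta>) * norm_sq_on I v \<and>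
        (x + \<delta>) * norm_sq_on I w \<le> quad_form_on I (D (-1)) w"
      by (intro allI split)
    then obtain V where "\<forall>k. \<exists>w. (\<forall>i\<in>I. ?f k i = (V k) i + w i) \<and> norm_sq_on I (V k) \<le> C * norm_sq_on I (?f k) \<and>
        norm_sq_on I w \<le> C * norm_sq_on I (?f k) \<and> quad_form_on I (D 1) (V k) \<le> (x - \<delta>) * norm_sq_on I (V k) \<and>
        (x + \<delta>) * norm_sq_on I w \<le> quad_form_on I (D (-1)) w"
      by (rule exE[OF choice])
    then obtain W where VW: "\<forall>k. (\<forall>i\<in>I. ?f k i = (V k) i + (W k) i) \<and> norm_sq_on I (V k) \<le> C * norm_sq_on I (?f k) \<and>
        norm_sq_on I (W k) \<le> C * norm_sq_on I (?f k) \<and> quad_form_on I (D 1) (V k) \<le> (x - \<delta>) * norm_sq_on I (V k) \<and>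
        (x + \<delta>) * norm_sq_on I (W k) \<le> quad_form_on I (D (-1)) (W k)"
      by (rule exE[OF choice])
    obtain v where v: "\<And>k q. q \<in> I \<Longrightarrow> cell_vec c p (seq v) k q = V k q"
      using assemble_cells[of V C u] VW by blast
    obtain w where w: "\<And>k q. q \<in> I \<Longrightarrow> cell_vec c p (seq w) k q = W k q"
      using assemble_cells[of W C u] VW by blast
    have u: "u = v + w"
    proof (rule l2seq_eqI)
      fix n
      obtain k j where n: "n = c + k * int p + int j" "j < p"
        using bij_betw_imp_surj_on[OF cell_bij[OF p, of c]] by (auto simp: image_iff set_eq_iff) blast
      have "seq u n $ i = (seq v n + seq w n) $ i" for i
      proof -
        have "(j, i) \<in> I" using n by simp
        then show ?thesis
          using VW[rule_format, of k] v[of "(j, i)" k] w[of "(j, i)" k] unfolding n(1) by (force simp: cell_vec_def)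
      qed
      then show "seq u n = seq (v + w) n" by (simp add: plus_l2seq.rep_eq vec_eq_iff)
    qed
    have Jv: "inner (J v) v \<le> (x - \<delta>) * (norm v)\<^sup>2"
    proof (rule J_upper)
      show "quad_form_on I (D 1) (cell_vec c p (seq v) k) \<le> (x - \<delta>) * norm_sq_on I (cell_vec c p (seq v) k)" for k
        using VW[rule_format, of k] quad_form_on_cong[of I "cell_vec c p (seq v) k" "V k", OF v]
          norm_sq_on_cong[of I "cell_vec c p (seq v) k" "V k", OF v] by simp
    qed
    have Jw: "(x + \<delta>) * (norm w)\<^sup>2 \<le> inner (J w) w"
    proof (rule J_lower)
      show "(x + \<delta>) * norm_sq_on I (cell_vec c p (seq w) k) \<le> quad_form_on I (D (-1)) (cell_vec c p (seq w) k)" for k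
        using VW[rule_format, of k] quad_form_on_cong[of I "cell_vec c p (seq w) k" "W k", OF w]
          norm_sq_on_cong[of I "cell_vec c p (seq w) k" "W k", OF w] by simp
    qed
    interpret J: bounded_linear J by (rule J_bounded_linear)
    have "inner (J u - x *\<^sub>R u) (w - v) =
        (inner (J w) w - x * (norm w)\<^sup>2) - (inner (J v) v - x * (norm v)\<^sup>2)"
      using J_symmetric[of v w]
      by (simp add: u J.add inner_add_left inner_add_right inner_diff_left inner_diff_right
          power2_norm_eq_inner inner_commute[of w v] inner_commute[of "J w" v] algebra_simps)
    then have "\<delta> * ((norm v)\<^sup>2 + (norm w)\<^sup>2) \<le> inner (J u - x *\<^sub>R u) (w - v)"
      using Jv Jw by (simp add: algebra_simps)
    also have "\<dots> \<le> norm (J u - x *\<^sub>R u) * norm (w - v)" by (rule norm_cauchy_schwarz)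
    also have "\<dots> \<le> norm (J u - x *\<^sub>R u) * (norm v + norm w)"
      using norm_triangle_ineq4[of w v] by (intro mult_left_mono) auto
    finally have le: "\<delta> * ((norm v)\<^sup>2 + (norm w)\<^sup>2) \<le> norm (J u - x *\<^sub>R u) * (norm v + norm w)" .
    have "(norm v + norm w)\<^sup>2 \<le> 2 * ((norm v)\<^sup>2 + (norm w)\<^sup>2)"
      using sum_squares_bound[of "norm v" "norm w"] by (simp add: power2_sum)
    then have "\<delta> * ((norm v + norm w)\<^sup>2 / 2) \<le> \<delta> * ((norm v)\<^sup>2 + (norm w)\<^sup>2)"
      using \<delta> by (intro mult_left_mono) auto
    then have le2: "(\<delta> / 2 * (norm v + norm w)) * (norm v + norm w) \<le> norm (J u - x *\<^sub>R u) * (norm v + norm w)"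
      using le by (simp add: power2_eq_square)
    have "\<delta> / 2 * (norm v + norm w) \<le> norm (J u - x *\<^sub>R u)"
    proof (cases "norm v + norm w = 0")
      case False
      then have "norm v + norm w > 0" using norm_ge_zero[of v] norm_ge_zero[of w] by linarith
      then show ?thesis using le2 by (simp only: mult_le_cancel_right_pos)
    qed simp
    moreover have "\<delta> / 2 * norm u \<le> \<delta> / 2 * (norm v + norm w)"
      using \<delta> norm_triangle_ineq[of v w] unfolding u by (intro mult_left_mono) auto
    ultimately show ?thesis by linarith
  qed
  then show ?thesis using that[of "\<delta> / 2"] \<delta> by simp
qed

end

section \<open>The resolvent set of the Jacobi operator\<close>

lemma of_real_vector_scalar_mult: "complex_of_real r *s x = r *\<^sub>R x" for x :: "complex^'m"
  by (simp add: vec_eq_iff scaleR_complex)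

lemma ell2_iff: "y \<in> ell2 \<longleftrightarrow> sq_summable y"
  by (simp add: ell2_def sq_summable_def)

lemma ell2_norm_seq: "ell2_norm (seq u) = norm u"
  by (simp add: ell2_norm_def l2seq_norm_sq[symmetric])

text \<open>
  The inverse found on the real Hilbert space is automatically complex linear, since it inverts
  the complex linear map \<open>J - x\<close>.
\<close>
lemma (in periodic_jacobi) resolvent_if_splits:
  assumes "splits_at I (D (-1)) (D 1) x"
  shows "complex_of_real x \<in> resolvent_set (jacobi a b)"
proof -
  define B where "B u = J u - x *\<^sub>R u" for u
  obtain \<epsilon> where \<epsilon>: "\<epsilon> > 0" "\<And>u. \<epsilon> * norm u \<le> norm (B u)"
    using J_bounded_below[OF assms] unfolding B_def by blast
  have lin: "bounded_linear B"
    unfolding B_def by (intro bounded_linear_sub J_bounded_linear bounded_linear_scaleR_right)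
  interpret B: bounded_linear B by (rule lin)
  have surj: "surj B"
  proof (rule symmetric_bounded_below_surj[OF lin _ \<epsilon>])
    show "inner (B u) v = inner u (B v)" for u v
      by (simp add: B_def inner_diff_left inner_diff_right J_symmetric)
  qed
  have inj: "u = v" if "B u = B v" for u v
  proof -
    have "B (u - v) = 0" using that by (simp add: B.diff)
    then have "\<epsilon> * norm (u - v) \<le> 0" using \<epsilon>(2)[of "u - v"] by simp
    then show ?thesis using \<epsilon>(1) by (simp add: mult_le_0_iff)
  qed
  have seq_B: "seq (B u) = (\<lambda>n. jacobi a b (seq u) n - complex_of_real x *s seq u n)" for u
    by (simp add: fun_eq_iff B_def minus_l2seq.rep_eq scaleR_l2seq.rep_eq seq_J of_real_vector_scalar_mult)
  define R where "R y = seq (inv B (Abs_l2seq y))" for y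
  have R_seq: "R (seq u) = seq (inv B u)" for u by (simp add: R_def seq_inverse)
  have BR: "B (inv B u) = u" for u by (rule surj_f_inv_f[OF surj])
  have R_eqI: "R y = seq u" if "y = seq (B u)" for y u
    unfolding that R_seq using inj[OF BR] by simp
  have ell2_seq: "\<exists>u. y = seq u" if "y \<in> ell2" for y :: "int \<Rightarrow> complex^'m"
    using that seq_Abs[of y] by (intro exI[of _ "Abs_l2seq y"]) (simp add: ell2_iff)
  have seq_ell2: "seq u \<in> ell2" for u :: "(complex^'m) l2seq" by (simp add: ell2_iff seq_sq_summable)
  have scale: "\<exists>v. seq v = (\<lambda>n. z *s seq u n)" for z and u :: "(complex^'m) l2seq"
  proof (intro exI ext)
    have "mat z *v y = z *s y" for y :: "complex^'m"
      by (simp add: vec_eq_iff matrix_vector_mult_def mat_def if_distrib[where f = "\<lambda>t. t * _"] cong: if_cong)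
    moreover have "bounded_family (\<lambda>_. mat z :: complex^'m^'m)"
      by (rule periodic_bounded_family[OF p refl])
    ultimately show "seq (mat_op (\<lambda>_. mat z) u) n = z *s seq u n" for n
      by (simp add: seq_mat_op)
  qed
  have "bounded_op R"
    unfolding bounded_op_def
  proof (intro conjI ballI allI)
    fix y :: "int \<Rightarrow> complex^'m" assume "y \<in> ell2"
    then show "R y \<in> ell2" using ell2_seq R_seq seq_ell2 by metis
  next
    fix y z :: "int \<Rightarrow> complex^'m" assume "y \<in> ell2" "z \<in> ell2"
    then obtain u v where uv: "y = seq u" "z = seq v" using ell2_seq by blast
    have "R (\<lambda>n. y n + z n) = seq (inv B u + inv B v)"
      by (rule R_eqI) (simp add: B.add BR uv plus_l2seq.rep_eq)
    then show "R (\<lambda>n. y n + z n) = (\<lambda>n. R y n + R z n)"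
      by (simp add: uv R_seq plus_l2seq.rep_eq)
  next
    fix z and y :: "int \<Rightarrow> complex^'m" assume "y \<in> ell2"
    then obtain u where u: "y = seq u" using ell2_seq by blast
    obtain v where v: "seq v = (\<lambda>n. z *s seq (inv B u) n)" using scale by blast
    have "R (\<lambda>n. z *s y n) = seq v"
    proof (rule R_eqI)
      have "(\<lambda>n. z *s seq (B (inv B u)) n) = seq (B v)"
        unfolding seq_B v jacobi_def
        by (simp add: fun_eq_iff vec_eq_iff matrix_vector_mult_def sum_distrib_left algebra_simps)
      then show "(\<lambda>n. z *s y n) = seq (B v)" by (simp add: BR u)
    qed
    then show "R (\<lambda>n. z *s y n) = (\<lambda>n. z *s R y n)" by (simp add: v u R_seq)
  next
    have "ell2_norm (R y) \<le> 1 / \<epsilon> * ell2_norm y" if "y \<in> ell2" for y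
    proof -
      obtain u where u: "y = seq u" using ell2_seq[OF \<open>y \<in> ell2\<close>] by blast
      show ?thesis
        using \<epsilon>(2)[of "inv B u"] \<epsilon>(1) by (simp add: u R_seq ell2_norm_seq BR field_simps)
    qed
    then show "\<exists>C. \<forall>y\<in>ell2. ell2_norm (R y) \<le> C * ell2_norm y" by blast
  qed
  moreover have "R (\<lambda>n. jacobi a b y n - complex_of_real x *s y n) = y" if y: "y \<in> ell2" for y
  proof -
    obtain u where u: "y = seq u" using ell2_seq[OF y] by blast
    show ?thesis unfolding u by (rule R_eqI) (simp add: seq_B)
  qed
  moreover have "(\<lambda>n. jacobi a b (R y) n - complex_of_real x *s R y n) = y" if y: "y \<in> ell2" for y
  proof -
    obtain u where u: "y = seq u" using ell2_seq[OF y] by blast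
    show ?thesis unfolding u R_seq seq_B[symmetric] BR ..
  qed
  ultimately show ?thesis unfolding resolvent_set_def by blast
qed

theorem theorem1p1:
  fixes a b :: "int \<Rightarrow> complex^'m^'m" and p :: nat
  assumes "p \<ge> 1"
    and "\<And>n. a (n + int p) = a n"
    and "\<And>n. b (n + int p) = b n"
    and "\<And>n. hermitian (b n)"
  shows "emeasure lebesgue {x::real. complex_of_real x \<in> spectrum (jacobi a b)}
           \<le> ennreal (4 * Min (range (\<lambda>n. Re (trace (psd_sqrt (a n ** conj_transpose (a n)))))))"
proof -
  define tr where "tr n = Re (trace (psd_sqrt (a n ** conj_transpose (a n))))" for n
  have "range tr = tr ` {0..<int p}"
    by (rule periodic_range[OF assms(1)]) (simp add: tr_def assms(2))
  then have "finite (range tr)" by simp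
  then have "Min (range tr) \<in> range tr" by (intro Min_in) auto
  then obtain n0 where n0: "Min (range tr) = tr n0" by blast
  obtain Q where Q: "hermitian (psd_sqrt (a n0 ** conj_transpose (a n0)))" "hermitian Q"
    "trace Q = trace (psd_sqrt (a n0 ** conj_transpose (a n0)))"
    "\<And>x y. \<bar>2 * inner x (a n0 *v y)\<bar> \<le> inner x (psd_sqrt (a n0 ** conj_transpose (a n0)) *v x) + inner y (Q *v y)"
    by (rule psd_sqrt_gram_dominates[of "a n0"]) blast
  interpret periodic_jacobi a b p "psd_sqrt (a n0 ** conj_transpose (a n0))" Q n0
    by unfold_locales (use assms Q in blast)+
  obtain Z where Z: "Z \<in> sets lebesgue"
    "emeasure lebesgue Z \<le> ennreal (Re (\<Sum>q\<in>I. D 1 q q - D (-1) q q))"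
    "\<And>x. x \<notin> Z \<Longrightarrow> splits_at I (D (-1)) (D 1) x"
  proof (rule splits_at_outside_small_set[of I "D (-1)" "D 1"])
    show "finite I" by simp
  qed (use decoupled_hermitian decoupled_mono in blast)+
  have "{x. complex_of_real x \<in> spectrum (jacobi a b)} \<subseteq> Z"
    using Z(3) resolvent_if_splits by (auto simp: spectrum_def)
  then have "emeasure lebesgue {x. complex_of_real x \<in> spectrum (jacobi a b)} \<le> emeasure lebesgue Z"
    using Z(1) by (rule emeasure_mono)
  also have "\<dots> \<le> ennreal (4 * tr n0)"
    using Z(2) unfolding decoupled_trace Q(3) by (simp add: tr_def)
  finally show ?thesis unfolding n0[symmetric] unfolding tr_def .
qed

end
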